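(* For every $k\in\mathbb{N}$, the operator $S\oplus(S_k^+)^*$ is cyclic, where $S$ is the simple bilateral shift on $\ell^2(\mathbb{Z})$ and $S_k^+$ is the orthogonal sum of $k$ copies of the simple unilateral shift $S^+$ on $\ell^2(\mathbb{N}_0)$.
   Context: $Se_n=e_{n+1}$ ($n\in\mathbb{Z}$) and $S^+e_n=e_{n+1}$ ($n\in\mathbb{N}_0$) for the standard orthonormal bases. An operator $T$ on $\mathcal{H}$ is cyclic if there is $h$ with $\bigvee\{T^nh:n\in\mathbb{N}_0\}=\mathcal{H}$. *)

theory Defs
  imports "HOL-Analysis.Analysis"
begin

text \<open>Concrete model of the complex Hilbert space
  l2(Z) (+) l2(N0)^k  as square-summable functions on the index type
  int + (nat * nat): index Inl n is the basis vector e_n of l2(Z), index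
  Inr (j, n) with j < k is the basis vector e_n of the j-th copy of l2(N0).\<close>

type_synonym idx = "int + nat \<times> nat"

definition ell2_norm :: "('i \<Rightarrow> complex) \<Rightarrow> real" where
  "ell2_norm f = sqrt (\<Sum>\<^sub>\<infinity>i. (cmod (f i))\<^sup>2)"

definition H_space :: "nat \<Rightarrow> (idx \<Rightarrow> complex) set" where
  "H_space k = {f. (\<forall>j n. k \<le> j \<longrightarrow> f (Inr (j, n)) = 0)
                  \<and> (\<lambda>i. (cmod (f i))\<^sup>2) summable_on UNIV}"

text \<open>Bilateral shift S e_n = e_(n+1) on l2(Z): (S f)(n) = f(n-1).\<close>
definition bilateral_shift :: "(int \<Rightarrow> complex) \<Rightarrow> (int \<Rightarrow> complex)" where
  "bilateral_shift f = (\<lambda>n. f (n - 1))"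

text \<open>Adjoint of the unilateral shift S+ e_n = e_(n+1) on l2(N0):
  (S+)* e_n = e_(n-1), (S+)* e_0 = 0, i.e. ((S+)* f)(n) = f(n+1).\<close>
definition unilateral_shift_adj :: "(nat \<Rightarrow> complex) \<Rightarrow> (nat \<Rightarrow> complex)" where
  "unilateral_shift_adj f = (\<lambda>n. f (Suc n))"

definition T_op :: "(idx \<Rightarrow> complex) \<Rightarrow> (idx \<Rightarrow> complex)" where
  "T_op f = (\<lambda>i. case i of
       Inl n \<Rightarrow> bilateral_shift (\<lambda>m. f (Inl m)) n
     | Inr (j, n) \<Rightarrow> unilateral_shift_adj (\<lambda>m. f (Inr (j, m))) n)"

definition cyclic_op :: "('i \<Rightarrow> complex) set \<Rightarrow> (('i \<Rightarrow> complex) \<Rightarrow> ('i \<Rightarrow> complex)) \<Rightarrow> bool" where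
  "cyclic_op V T \<longleftrightarrow> (\<exists>h\<in>V. \<forall>f\<in>V. \<forall>e>0. \<exists>N::nat. \<exists>c::nat \<Rightarrow> complex.
      ell2_norm (\<lambda>i. f i - (\<Sum>m<N. c m * (T ^^ m) h i)) < e)"

end

theory Submission
  imports Defs "HOL-Complex_Analysis.Complex_Analysis"
begin

text \<open>
  Let \<open>\<phi>(z) = exp (-1 / |1 + z|\<^sup>2)\<close> on the unit circle and let \<open>g\<close> be its sequence of Fourier coefficients.

  \<^emph>\<open>The vector \<open>g\<close> is cyclic for \<open>S\<close>.\<close> By Bessel's inequality it suffices to approximate uniformly on
  the circle by functions \<open>p \<phi>\<close> with \<open>p\<close> a polynomial. For \<open>F(w) = exp (-2 n w / (1 + w))\<close>
  we have \<open>F(0) = 1\<close> and \<open>|F(r z)| \<phi>(z) \<le> exp (-n)\<close> for \<open>r\<close> close to 1, so \<open>g\<close> is a limit of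
  combinations of \<open>S g, S\<^sup>2 g, \<dots>\<close> and its cyclic subspace is invariant under the inverse of \<open>S\<close>.
  On the circle \<open>1 / \<phi>(z) = exp (z / (1 + z)\<^sup>2)\<close>, which is holomorphic in the disc, so its dilates
  show that \<open>1 + z\<close> is a uniform limit of functions \<open>p \<phi>\<close>.

  \<^emph>\<open>Adding the backward shifts.\<close> Choose polynomials \<open>p\<^sub>i\<close> with \<open>p\<^sub>i(0) = 1\<close> and positive \<open>\<epsilon>\<^sub>i\<close> such that
  \<open>p\<^sub>i(S) g\<close> is small compared with \<open>\<epsilon>\<^sub>i\<close>, and \<open>\<epsilon>\<^sub>l\<close> for \<open>l > i\<close> is small compared with
  \<open>\<epsilon>\<^sub>i\<close> divided by the coefficient sum of \<open>p\<^sub>i\<close>. Let \<open>h\<close> be \<open>g\<close> plus the sum over \<open>i\<close> of \<open>\<epsilon>\<^sub>i\<close> times the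
  \<open>i\<close>-th basis vector of the copy with number \<open>i mod k\<close>. Then \<open>p\<^sub>i(T) T\<^sup>i\<^sup>-\<^sup>r h / \<epsilon>\<^sub>i\<close> is close to the
  \<open>r\<close>-th basis vector of that copy, up to basis vectors of lower index. Induction on \<open>r\<close> puts all
  these basis vectors into the cyclic subspace of \<open>h\<close>, which therefore also contains \<open>g\<close>.
\<close>

section \<open>Square-summable families and injective index maps\<close>

text \<open>Membership is tracked apart from the norm: \<open>infsum\<close> defaults to 0, so
  \<open>ell2_norm\<close> is 0 on families that are not square summable and a small norm alone says
  nothing.\<close>

definition ell2 :: "('i \<Rightarrow> complex) set" where
  "ell2 = {f. (\<lambda>i. (cmod (f i))\<^sup>2) summable_on UNIV}"

lemma sum_le_ell2_norm:
  assumes "f \<in> ell2" "finite F"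
  shows "(\<Sum>i\<in>F. (cmod (f i))\<^sup>2) \<le> (ell2_norm f)\<^sup>2"
  using assms by (auto simp: ell2_def ell2_norm_def infsum_nonneg intro!: finite_sum_le_infsum)

lemma ell2_norm_nonneg [simp]: "0 \<le> ell2_norm f"
  by (simp add: ell2_norm_def infsum_nonneg)

lemma ell2_boundI:
  assumes "\<And>F. finite F \<Longrightarrow> (\<Sum>i\<in>F. (cmod (f i))\<^sup>2) \<le> b\<^sup>2" "0 \<le> b"
  shows ell2_boundI_mem: "f \<in> ell2" and ell2_norm_leI: "ell2_norm f \<le> b"
proof -
  have s: "(\<lambda>i. (cmod (f i))\<^sup>2) summable_on UNIV"
    using assms by (intro nonneg_bdd_above_summable_on bdd_aboveI2[where M="b\<^sup>2"]) auto
  then show "f \<in> ell2" by (simp add: ell2_def)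
  show "ell2_norm f \<le> b" unfolding ell2_norm_def
    using infsum_le_finite_sums[OF s assms(1)] assms(2) by (intro real_le_lsqrt) (auto simp: infsum_nonneg)
qed

text \<open>The squares of \<open>g\<close> are compared with those of \<open>f\<close> over the
  image of the support of \<open>g\<close>. Injectivity is asked on that support only, so
  \<open>\<sigma>\<close> may be a partial inverse such as \<open>projl\<close>.\<close>

lemma ell2_reindex:
  assumes "f \<in> ell2" "inj_on \<sigma> {i. g i \<noteq> 0}" "\<And>i. g i \<noteq> 0 \<Longrightarrow> cmod (g i) \<le> cmod (f (\<sigma> i))"
  shows ell2_reindex_mem: "g \<in> ell2" and ell2_norm_reindex_le: "ell2_norm g \<le> ell2_norm f"
proof -
  have *: "(\<Sum>i\<in>F. (cmod (g i))\<^sup>2) \<le> (ell2_norm f)\<^sup>2" if "finite F" for F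
  proof -
    let ?G = "{i\<in>F. g i \<noteq> 0}"
    have inj: "inj_on \<sigma> ?G" using assms(2) by (rule inj_on_subset) auto
    have "(\<Sum>i\<in>F. (cmod (g i))\<^sup>2) = (\<Sum>i\<in>?G. (cmod (g i))\<^sup>2)"
      using that by (intro sum.mono_neutral_right) auto
    also have "\<dots> \<le> (\<Sum>i\<in>?G. (cmod (f (\<sigma> i)))\<^sup>2)"
      using assms(3) by (intro sum_mono power_mono) auto
    also have "\<dots> = (\<Sum>i\<in>\<sigma> ` ?G. (cmod (f i))\<^sup>2)"
      by (simp add: sum.reindex[OF inj])
    also have "\<dots> \<le> (ell2_norm f)\<^sup>2"
      using assms(1) that by (intro sum_le_ell2_norm) auto
    finally show ?thesis .
  qed
  show "g \<in> ell2" "ell2_norm g \<le> ell2_norm f"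
    by (rule ell2_boundI[OF *]; simp)+
qed

text \<open>Minkowski's inequality on a finite index set gives a bound that does not depend on the
  set.\<close>

lemma ell2_add:
  assumes "f \<in> ell2" "g \<in> ell2"
  shows ell2_add_mem: "(\<lambda>i. f i + g i) \<in> ell2"
    and ell2_norm_triangle: "ell2_norm (\<lambda>i. f i + g i) \<le> ell2_norm f + ell2_norm g"
proof -
  have *: "(\<Sum>i\<in>F. (cmod (f i + g i))\<^sup>2) \<le> (ell2_norm f + ell2_norm g)\<^sup>2" if "finite F" for F
  proof -
    have L: "L2_set (\<lambda>i. cmod (f' i)) F \<le> ell2_norm f'" if "f' \<in> ell2" for f'
      unfolding L2_set_def using sum_le_ell2_norm[OF that \<open>finite F\<close>] by (intro real_le_lsqrt) (auto simp: sum_nonneg)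
    have "L2_set (\<lambda>i. cmod (f i + g i)) F \<le> L2_set (\<lambda>i. cmod (f i) + cmod (g i)) F"
      by (intro L2_set_mono norm_triangle_ineq) auto
    also have "\<dots> \<le> L2_set (\<lambda>i. cmod (f i)) F + L2_set (\<lambda>i. cmod (g i)) F"
      by (rule L2_set_triangle_ineq)
    also have "\<dots> \<le> ell2_norm f + ell2_norm g"
      using L assms by (intro add_mono) auto
    finally show ?thesis
      unfolding L2_set_def by (simp add: sqrt_le_D)
  qed
  show "(\<lambda>i. f i + g i) \<in> ell2" "ell2_norm (\<lambda>i. f i + g i) \<le> ell2_norm f + ell2_norm g"
    by (rule ell2_boundI[OF *]; simp)+
qed

lemma ell2_norm_scale: "ell2_norm (\<lambda>i. a * f i) = cmod a * ell2_norm f"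
  by (simp add: ell2_norm_def norm_mult power_mult_distrib infsum_cmult_right' real_sqrt_mult)

lemma ell2_scale: "f \<in> ell2 \<Longrightarrow> (\<lambda>i. a * f i) \<in> ell2"
  by (simp add: ell2_def norm_mult power_mult_distrib summable_on_cmult_right)

lemma ell2_norm_zero [simp]: "ell2_norm (\<lambda>i. 0) = 0"
  by (simp add: ell2_norm_def)

lemma ell2_zero [simp]: "(\<lambda>i. 0) \<in> ell2"
  by (simp add: ell2_def)

lemma ell2_diff_mem:
  assumes "f \<in> ell2" "g \<in> ell2"
  shows "(\<lambda>i. f i - g i) \<in> ell2"
  using ell2_add_mem[OF assms(1) ell2_scale[OF assms(2), of "-1"]] by simp

lemma ell2_sum:
  assumes "\<And>m. m \<in> A \<Longrightarrow> f m \<in> ell2"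
  shows ell2_sum_mem: "(\<lambda>i. \<Sum>m\<in>A. f m i) \<in> ell2"
    and ell2_norm_sum_le: "ell2_norm (\<lambda>i. \<Sum>m\<in>A. f m i) \<le> (\<Sum>m\<in>A. ell2_norm (f m))"
proof -
  have "(\<lambda>i. \<Sum>m\<in>A. f m i) \<in> ell2 \<and> ell2_norm (\<lambda>i. \<Sum>m\<in>A. f m i) \<le> (\<Sum>m\<in>A. ell2_norm (f m))"
    using assms
  proof (induction A rule: infinite_finite_induct)
    case (insert x F)
    then show ?case
      using ell2_add[of "f x" "\<lambda>i. \<Sum>m\<in>F. f m i"] by fastforce
  qed auto
  then show "(\<lambda>i. \<Sum>m\<in>A. f m i) \<in> ell2" "ell2_norm (\<lambda>i. \<Sum>m\<in>A. f m i) \<le> (\<Sum>m\<in>A. ell2_norm (f m))"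
    by auto
qed

lemma ell2_finite_approx:
  assumes "f \<in> ell2" "0 < e"
  obtains F where "finite F" "ell2_norm (\<lambda>i. if i \<in> F then 0 else f i) < e"
proof -
  let ?s = "\<lambda>i. (cmod (f i))\<^sup>2"
  have s: "?s summable_on UNIV" using assms(1) by (simp add: ell2_def)
  have "0 < (e/2)\<^sup>2" using assms(2) by simp
  then obtain F where F: "finite F" "F \<subseteq> UNIV" "dist (sum ?s F) (infsum ?s UNIV) \<le> (e/2)\<^sup>2"
    using infsum_finite_approximation[OF s] by blast
  have "(\<Sum>i\<in>G. (cmod (if i \<in> F then 0 else f i))\<^sup>2) \<le> (e/2)\<^sup>2" if "finite G" for G
  proof -
    have "(\<Sum>i\<in>G. (cmod (if i \<in> F then 0 else f i))\<^sup>2) = sum ?s (G - F)"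
      using that by (intro sum.mono_neutral_cong_right) auto
    also have "\<dots> = sum ?s (G \<union> F) - sum ?s F"
      using that F(1) by (simp add: sum_diff[symmetric] Un_Diff)
    also have "sum ?s (G \<union> F) \<le> infsum ?s UNIV"
      using that F(1) s by (intro finite_sum_le_infsum) auto
    finally show ?thesis using F(3) by (simp add: dist_real_def)
  qed
  then have "ell2_norm (\<lambda>i. if i \<in> F then 0 else f i) \<le> e/2"
    using assms(2) by (intro ell2_norm_leI) auto
  with F(1) assms(2) show ?thesis by (intro that[of F]) auto
qed

definition basis_vec :: "'i \<Rightarrow> 'i \<Rightarrow> complex" where
  "basis_vec i = (\<lambda>j. if j = i then 1 else 0)"

lemma ell2_finite_support:
  assumes "finite {i. f i \<noteq> 0}"
  shows "f \<in> ell2"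
proof -
  have "(\<Sum>i\<in>F. (cmod (f i))\<^sup>2) \<le> (sqrt (\<Sum>i\<in>{i. f i \<noteq> 0}. (cmod (f i))\<^sup>2))\<^sup>2" if "finite F" for F
  proof -
    have "(\<Sum>i\<in>F. (cmod (f i))\<^sup>2) = (\<Sum>i\<in>{i\<in>F. f i \<noteq> 0}. (cmod (f i))\<^sup>2)"
      using that by (intro sum.mono_neutral_right) auto
    also have "\<dots> \<le> (\<Sum>i\<in>{i. f i \<noteq> 0}. (cmod (f i))\<^sup>2)"
      using assms by (intro sum_mono2) auto
    finally show ?thesis by (simp add: sum_nonneg)
  qed
  then show ?thesis by (rule ell2_boundI_mem) (auto intro!: real_sqrt_ge_zero sum_nonneg)
qed

lemma basis_vec_ell2: "basis_vec i \<in> ell2"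
  by (rule ell2_finite_support) (simp add: basis_vec_def)

text \<open>Both operators have the form \<open>f \<mapsto> f \<circ> \<sigma>\<close> with \<open>\<sigma>\<close> injective; \<open>poly_comp \<sigma> N c\<close> is the polynomial with
  coefficients \<open>c\<close> in such an operator.\<close>

definition poly_comp :: "('i \<Rightarrow> 'i) \<Rightarrow> nat \<Rightarrow> (nat \<Rightarrow> complex) \<Rightarrow> ('i \<Rightarrow> complex) \<Rightarrow> 'i \<Rightarrow> complex" where
  "poly_comp \<sigma> N c f = (\<lambda>i. \<Sum>m<N. c m * f ((\<sigma> ^^ m) i))"

lemma poly_comp_funpow:
  "poly_comp \<sigma> N c f ((\<sigma> ^^ m) i) = poly_comp \<sigma> N c (\<lambda>i. f ((\<sigma> ^^ m) i)) i"
proof -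
  have "(\<sigma> ^^ n) ((\<sigma> ^^ m) i) = (\<sigma> ^^ m) ((\<sigma> ^^ n) i)" for n
    by (metis add.commute comp_apply funpow_add)
  then show ?thesis by (simp add: poly_comp_def)
qed

lemma poly_comp_add:
  "poly_comp \<sigma> N c (\<lambda>i. f i + g i) i = poly_comp \<sigma> N c f i + poly_comp \<sigma> N c g i"
  by (simp add: poly_comp_def ring_distribs sum.distrib)

lemma poly_comp_scale:
  "poly_comp \<sigma> N c (\<lambda>i. a * f i) i = a * poly_comp \<sigma> N c f i"
  by (simp add: poly_comp_def sum_distrib_left mult_ac)

text \<open>For injective \<open>\<sigma>\<close> and square-summable \<open>g\<close> this is the
  closed linear span of the orbit of \<open>g\<close> under composition with
  \<open>\<sigma>\<close>.\<close>

definition cyclic_space :: "('i \<Rightarrow> 'i) \<Rightarrow> ('i \<Rightarrow> complex) \<Rightarrow> ('i \<Rightarrow> complex) set" where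
  "cyclic_space \<sigma> g = {f \<in> ell2. \<forall>e>0. \<exists>N c. ell2_norm (\<lambda>i. f i - poly_comp \<sigma> N c g i) < e}"

lemma comp_power:
  fixes \<sigma> :: "'i \<Rightarrow> 'i" and f :: "'i \<Rightarrow> 'b"
  shows "((\<lambda>f. f \<circ> \<sigma>) ^^ m) f = f \<circ> (\<sigma> ^^ m)"
  by (induction m) (auto simp: fun_eq_iff funpow_swap1)

section \<open>Cyclic subspaces of composition with an injective map\<close>

locale inj_comp =
  fixes \<sigma> :: "'i \<Rightarrow> 'i"
  assumes inj: "inj \<sigma>"
begin

lemma inj_pow: "inj (\<sigma> ^^ m)"
  using inj by (rule inj_fn)

lemma comp_ell2:
  assumes "f \<in> ell2"
  shows comp_ell2_mem: "(\<lambda>i. f ((\<sigma> ^^ m) i)) \<in> ell2"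
    and ell2_norm_comp_le: "ell2_norm (\<lambda>i. f ((\<sigma> ^^ m) i)) \<le> ell2_norm f"
  using assms inj_pow[of m] by (auto intro!: ell2_reindex[where \<sigma>="\<sigma> ^^ m" and f=f] intro: inj_on_subset)

lemma poly_comp_ell2:
  assumes "f \<in> ell2"
  shows poly_comp_mem: "poly_comp \<sigma> N c f \<in> ell2"
    and ell2_norm_poly_comp_le: "ell2_norm (poly_comp \<sigma> N c f) \<le> (\<Sum>m<N. cmod (c m)) * ell2_norm f"
proof -
  show "poly_comp \<sigma> N c f \<in> ell2"
    unfolding poly_comp_def using assms by (intro ell2_sum_mem ell2_scale comp_ell2_mem)
  have "ell2_norm (poly_comp \<sigma> N c f) \<le> (\<Sum>m<N. ell2_norm (\<lambda>i. c m * f ((\<sigma> ^^ m) i)))"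
    unfolding poly_comp_def using assms by (intro ell2_norm_sum_le ell2_scale comp_ell2_mem)
  also have "\<dots> \<le> (\<Sum>m<N. cmod (c m) * ell2_norm f)"
    unfolding ell2_norm_scale using assms by (intro sum_mono mult_left_mono ell2_norm_comp_le) auto
  finally show "ell2_norm (poly_comp \<sigma> N c f) \<le> (\<Sum>m<N. cmod (c m)) * ell2_norm f"
    by (simp add: sum_distrib_right)
qed

text \<open>Closedness of the cyclic space, by an \<open>e/2\<close> argument. Later membership
  proofs mostly go through this rule.\<close>

lemma cyclic_spaceI:
  assumes "f \<in> ell2" "g \<in> ell2"
    and "\<And>e. e > 0 \<Longrightarrow> \<exists>f'\<in>cyclic_space \<sigma> g. ell2_norm (\<lambda>i. f i - f' i) < e"
  shows "f \<in> cyclic_space \<sigma> g"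
proof -
  have "\<exists>N c. ell2_norm (\<lambda>i. f i - poly_comp \<sigma> N c g i) < e" if e: "e > 0" for e
  proof -
    obtain f' where f': "f' \<in> cyclic_space \<sigma> g" "ell2_norm (\<lambda>i. f i - f' i) < e/2"
      using assms(3)[of "e/2"] e by auto
    then obtain N c where c: "ell2_norm (\<lambda>i. f' i - poly_comp \<sigma> N c g i) < e/2"
      using e by (auto simp: cyclic_space_def dest!: spec[of _ "e/2"])
    have "f' \<in> ell2" using f' by (simp add: cyclic_space_def)
    then have "ell2_norm (\<lambda>i. (f i - f' i) + (f' i - poly_comp \<sigma> N c g i))
        \<le> ell2_norm (\<lambda>i. f i - f' i) + ell2_norm (\<lambda>i. f' i - poly_comp \<sigma> N c g i)"
      using assms by (intro ell2_norm_triangle ell2_diff_mem poly_comp_mem) 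
    with f' c have "ell2_norm (\<lambda>i. f i - poly_comp \<sigma> N c g i) < e" by simp
    then show ?thesis by blast
  qed
  with assms(1) show ?thesis by (simp add: cyclic_space_def)
qed

lemma cyclic_space_poly_comp:
  assumes "g \<in> ell2"
  shows "poly_comp \<sigma> N c g \<in> cyclic_space \<sigma> g"
  using assms unfolding cyclic_space_def
  by (auto simp: poly_comp_mem intro!: exI[of _ N] exI[of _ c])

lemma cyclic_space_base:
  assumes "g \<in> ell2"
  shows "g \<in> cyclic_space \<sigma> g"
  using cyclic_space_poly_comp[OF assms, of 1 "\<lambda>_. 1"] by (simp add: poly_comp_def)

lemma cyclic_space_ell2: "f \<in> cyclic_space \<sigma> g \<Longrightarrow> f \<in> ell2"
  by (simp add: cyclic_space_def)

lemma cyclic_space_add: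
  assumes "f \<in> cyclic_space \<sigma> g" "f' \<in> cyclic_space \<sigma> g" and g: "g \<in> ell2"
  shows "(\<lambda>i. f i + f' i) \<in> cyclic_space \<sigma> g"
proof (rule cyclic_spaceI)
  have fe: "f \<in> ell2" "f' \<in> ell2" using assms by (auto simp: cyclic_space_def)
  then show "(\<lambda>i. f i + f' i) \<in> ell2" by (rule ell2_add)
  fix e :: real assume "e > 0"
  then obtain N c N' c' where c: "ell2_norm (\<lambda>i. f i - poly_comp \<sigma> N c g i) < e/2"
    "ell2_norm (\<lambda>i. f' i - poly_comp \<sigma> N' c' g i) < e/2"
    using assms(1,2) by (auto simp: cyclic_space_def dest!: spec[of _ "e/2"])
  \<comment> \<open>Both coefficient lists are padded with zeros to a common length before they are
    added.\<close>
  define M where "M = max N N'"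
  define d where "d m = (if m < N then c m else 0) + (if m < N' then c' m else 0)" for m
  have pad: "(\<Sum>m<M. (if m < n then b m else 0) * x m) = (\<Sum>m<n. b m * x m)" 
    if "n \<le> M" for n and b x :: "nat \<Rightarrow> complex"
    using that by (intro sum.mono_neutral_cong_right) auto
  have eq: "poly_comp \<sigma> M d g i = poly_comp \<sigma> N c g i + poly_comp \<sigma> N' c' g i" for i
    unfolding poly_comp_def d_def ring_distribs sum.distrib
    by (subst (1 2) pad) (auto simp: M_def)
  have "ell2_norm (\<lambda>i. (f i - poly_comp \<sigma> N c g i) + (f' i - poly_comp \<sigma> N' c' g i))
      \<le> ell2_norm (\<lambda>i. f i - poly_comp \<sigma> N c g i) + ell2_norm (\<lambda>i. f' i - poly_comp \<sigma> N' c' g i)"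
    using fe g by (intro ell2_norm_triangle ell2_diff_mem poly_comp_mem)
  with c have "ell2_norm (\<lambda>i. (f i + f' i) - poly_comp \<sigma> M d g i) < e"
    by (simp add: eq algebra_simps)
  then show "\<exists>h\<in>cyclic_space \<sigma> g. ell2_norm (\<lambda>i. (f i + f' i) - h i) < e"
    using cyclic_space_poly_comp[OF g] by blast
qed (rule g)

lemma cyclic_space_scale:
  assumes "f \<in> cyclic_space \<sigma> g" and g: "g \<in> ell2"
  shows "(\<lambda>i. a * f i) \<in> cyclic_space \<sigma> g"
proof (rule cyclic_spaceI)
  have fe: "f \<in> ell2" using assms by (auto simp: cyclic_space_def)
  then show "(\<lambda>i. a * f i) \<in> ell2" by (rule ell2_scale)
  fix e :: real assume "e > 0"
  \<comment> \<open>Adding 1 to the modulus covers the case \<open>a = 0\<close>.\<close>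
  then have "e / (cmod a + 1) > 0" by (simp add: add_nonneg_pos)
  then obtain N c where c: "ell2_norm (\<lambda>i. f i - poly_comp \<sigma> N c g i) < e / (cmod a + 1)"
    using assms(1) by (auto simp: cyclic_space_def)
  have "ell2_norm (\<lambda>i. a * f i - poly_comp \<sigma> N (\<lambda>m. a * c m) g i) = cmod a * ell2_norm (\<lambda>i. f i - poly_comp \<sigma> N c g i)"
    by (simp add: ell2_norm_scale[symmetric] poly_comp_def sum_distrib_left algebra_simps)
  also have "\<dots> \<le> cmod a * (e / (cmod a + 1))"
    using c by (intro mult_left_mono) auto
  also have "\<dots> < e" using \<open>e > 0\<close> by (simp add: divide_simps add_nonneg_pos)
  finally show "\<exists>h\<in>cyclic_space \<sigma> g. ell2_norm (\<lambda>i. a * f i - h i) < e"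
    using cyclic_space_poly_comp[OF g] by blast
qed (rule g)

lemma cyclic_space_zero: "g \<in> ell2 \<Longrightarrow> (\<lambda>i. 0) \<in> cyclic_space \<sigma> g"
  using cyclic_space_poly_comp[of g 0] by (simp add: poly_comp_def)

lemma cyclic_space_diff:
  assumes "f \<in> cyclic_space \<sigma> g" "f' \<in> cyclic_space \<sigma> g" and g: "g \<in> ell2"
  shows "(\<lambda>i. f i - f' i) \<in> cyclic_space \<sigma> g"
  using cyclic_space_add[OF assms(1) cyclic_space_scale[OF assms(2) g, of "-1"] g] by simp

lemma cyclic_space_sum:
  assumes "\<And>m. m \<in> A \<Longrightarrow> f m \<in> cyclic_space \<sigma> g" and g: "g \<in> ell2"
  shows "(\<lambda>i. \<Sum>m\<in>A. f m i) \<in> cyclic_space \<sigma> g"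
  using assms
proof (induction A rule: infinite_finite_induct)
  case (insert x F)
  then show ?case
    using cyclic_space_add[of "f x" g "\<lambda>i. \<Sum>m\<in>F. f m i"] by simp
qed (auto intro: cyclic_space_zero)

lemma cyclic_space_comp1:
  assumes "f \<in> cyclic_space \<sigma> g" and g: "g \<in> ell2"
  shows "(\<lambda>i. f (\<sigma> i)) \<in> cyclic_space \<sigma> g"
proof (rule cyclic_spaceI)
  have fe: "f \<in> ell2" using assms by (auto simp: cyclic_space_def)
  from comp_ell2_mem[OF fe, of 1] show "(\<lambda>i. f (\<sigma> i)) \<in> ell2" by simp
  fix e :: real assume "e > 0"
  then obtain N c where c: "ell2_norm (\<lambda>i. f i - poly_comp \<sigma> N c g i) < e"
    using assms(1) by (auto simp: cyclic_space_def)
  have "ell2_norm (\<lambda>i. f (\<sigma> i) - poly_comp \<sigma> N c g (\<sigma> i)) \<le> ell2_norm (\<lambda>i. f i - poly_comp \<sigma> N c g i)"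
    using ell2_norm_comp_le[OF ell2_diff_mem[OF fe poly_comp_mem[OF g]], of 1 N c] by simp
  \<comment> \<open>One more application of the operator multiplies the polynomial by its variable:
    the coefficients move up by one place and the constant term becomes 0.\<close>
  moreover have "(\<lambda>i. poly_comp \<sigma> N c g (\<sigma> i)) = poly_comp \<sigma> (Suc N) (\<lambda>m. if m = 0 then 0 else c (m - 1)) g"
    by (simp add: poly_comp_def sum.lessThan_Suc_shift funpow_swap1 fun_eq_iff del: sum.lessThan_Suc)
  ultimately show "\<exists>h\<in>cyclic_space \<sigma> g. ell2_norm (\<lambda>i. f (\<sigma> i) - h i) < e"
    using cyclic_space_poly_comp[OF g] c by (intro bexI[where x="\<lambda>i. poly_comp \<sigma> N c g (\<sigma> i)"]) auto
qed (rule g)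

lemma cyclic_space_comp:
  assumes "f \<in> cyclic_space \<sigma> g" and g: "g \<in> ell2"
  shows "(\<lambda>i. f ((\<sigma> ^^ m) i)) \<in> cyclic_space \<sigma> g"
proof (induction m)
  case (Suc m)
  from cyclic_space_comp1[OF this g] show ?case by (simp add: funpow_swap1)
qed (use assms in simp)

lemma cyclic_space_poly_comp_mem:
  assumes "f \<in> cyclic_space \<sigma> g" and g: "g \<in> ell2"
  shows "poly_comp \<sigma> N c f \<in> cyclic_space \<sigma> g"
  unfolding poly_comp_def using assms by (intro cyclic_space_sum cyclic_space_scale cyclic_space_comp)

text \<open>Truncating \<open>f\<close> to finite sets gives finite combinations of basis vectors
  converging to \<open>f\<close>. Only basis vectors in the support of \<open>f\<close> enter, so
  families supported on the reachable copies are covered.\<close>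

lemma cyclic_space_of_basis:
  assumes "g \<in> ell2" "f \<in> ell2" "\<And>i. f i \<noteq> 0 \<Longrightarrow> basis_vec i \<in> cyclic_space \<sigma> g"
  shows "f \<in> cyclic_space \<sigma> g"
proof (rule cyclic_spaceI)
  fix e :: real assume "e > 0"
  then obtain F where F: "finite F" "ell2_norm (\<lambda>i. if i \<in> F then 0 else f i) < e"
    using ell2_finite_approx assms(2) by blast
  let ?p = "\<lambda>i. \<Sum>j\<in>F. f j * basis_vec j i"
  have "(\<lambda>i. f j * basis_vec j i) \<in> cyclic_space \<sigma> g" for j
    using assms(1,3) cyclic_space_zero[of g] by (cases "f j = 0") (auto intro!: cyclic_space_scale)
  then have "?p \<in> cyclic_space \<sigma> g" using assms(1) by (intro cyclic_space_sum)
  moreover have "?p i = (if i \<in> F then f i else 0)" for i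
    using F(1) by (simp add: basis_vec_def if_distrib[of "\<lambda>x. _ * x"] cong: if_cong)
  then have "(\<lambda>i. f i - ?p i) = (\<lambda>i. if i \<in> F then 0 else f i)" by (simp add: fun_eq_iff)
  ultimately show "\<exists>h\<in>cyclic_space \<sigma> g. ell2_norm (\<lambda>i. f i - h i) < e"
    using F(2) by (intro bexI[where x="?p"]) auto
qed (use assms in auto)

end

section \<open>Fourier coefficients\<close>

lemma borel_measurable_cis [measurable]: "cis \<in> borel_measurable borel"
  by (intro borel_measurable_continuous_onI continuous_intros)

lemma borel_measurable_cnj [measurable]: "cnj \<in> borel_measurable borel"
  by (intro borel_measurable_continuous_onI continuous_intros)

text \<open>Normalized arc length in terms of the angle; the factor \<open>1 / (2*pi)\<close> makes
  the characters \<open>cis (n * t)\<close> orthonormal.\<close>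

definition circle :: "real measure" where
  "circle = density lborel (\<lambda>t. ennreal (indicator {0..2*pi} t / (2*pi)))"

lemma sets_circle [measurable_cong]: "sets circle = sets borel"
  by (simp add: circle_def)

lemma space_circle [simp]: "space circle = UNIV"
  by (simp add: circle_def)

lemma measure_circle [simp]: "emeasure circle UNIV = 1"
proof -
  have "emeasure circle UNIV = (\<integral>\<^sup>+t. ennreal (1/(2*pi)) * indicator {0..2*pi} t \<partial>lborel)"
    unfolding circle_def by (subst emeasure_density) (auto intro!: nn_integral_cong split: split_indicator)
  also have "\<dots> = ennreal (1/(2*pi)) * ennreal (2*pi)"
    by (subst nn_integral_cmult_indicator) auto
  also have "\<dots> = 1" by (subst ennreal_mult'[symmetric]) auto
  finally show ?thesis .
qed

interpretation circle: finite_measure circle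
  by standard simp

lemma measure_circle' [simp]: "measure circle UNIV = 1"
  by (simp add: measure_def)

lemma integrable_circle:
  fixes f :: "real \<Rightarrow> 'b::{banach, second_countable_topology}"
  assumes "f \<in> borel_measurable borel" "\<And>t. norm (f t) \<le> B"
  shows "integrable circle f"
proof (rule circle.integrable_const_bound[of _ B])
  show "f \<in> borel_measurable circle" using assms(1) by measurable
qed (use assms in auto)

lemma integral_circle_cis: "(\<integral>t. cis (of_int n * t) \<partial>circle) = (if n = 0 then 1 else 0)"
proof (cases "n = 0")
  case False
  \<comment> \<open>An antiderivative of the character. It is periodic, so its boundary values
    cancel.\<close>
  let ?F = "\<lambda>t. cis (of_int n * t) / (\<i> * of_int n)"
  have "(\<integral>t. cis (of_int n * t) \<partial>circle) = (\<integral>t. (indicator {0..2*pi} t / (2*pi)) *\<^sub>R cis (of_int n * t) \<partial>lborel)"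
    unfolding circle_def by (subst integral_density) auto
  also have "\<dots> = (\<integral>t. (1/(2*pi)) *\<^sub>R (indicator {0..2*pi} t *\<^sub>R cis (of_int n * t)) \<partial>lborel)"
    by simp
  also have "\<dots> = (1/(2*pi)) *\<^sub>R (\<integral>t. indicator {0..2*pi} t *\<^sub>R cis (of_int n * t) \<partial>lborel)"
    by (rule integral_scaleR_right)
  also have "(\<integral>t. indicator {0..2*pi} t *\<^sub>R cis (of_int n * t) \<partial>lborel) = ?F (2*pi) - ?F 0"
  proof (rule integral_FTC_Icc)
    fix t :: real
    show "(?F has_vector_derivative cis (of_int n * t)) (at t within {0..2*pi})"
      unfolding cis_conv_exp using False
      by (auto intro!: derivative_eq_intros has_vector_derivative_real_field simp: mult_ac)
  qed (auto intro!: continuous_intros)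
  also have "?F (2*pi) = ?F 0"
    using cis_multiple_2pi[of "of_int n"] by (simp add: mult.commute mult.left_commute)
  finally show ?thesis using False by simp
qed auto

definition fourier :: "(complex \<Rightarrow> complex) \<Rightarrow> int \<Rightarrow> complex" where
  "fourier f n = (\<integral>t. f (cis t) * cis (- of_int n * t) \<partial>circle)"

definition bounded_circle :: "(complex \<Rightarrow> complex) \<Rightarrow> bool" where
  "bounded_circle f \<longleftrightarrow> f \<in> borel_measurable borel \<and> (\<exists>B. \<forall>t. cmod (f (cis t)) \<le> B)"

lemma bounded_circle_integrable:
  assumes "bounded_circle f"
  shows "integrable circle (\<lambda>t. f (cis t) * cis (- of_int n * t))"
proof -
  obtain B where B: "\<And>t. cmod (f (cis t)) \<le> B" and [measurable]: "f \<in> borel_measurable borel"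
    using assms by (auto simp: bounded_circle_def)
  show ?thesis
    by (rule integrable_circle[where B=B]) (auto simp: norm_mult B)
qed

text \<open>Let \<open>s\<close> be a partial Fourier sum and \<open>S\<close> the sum of the
  squared moduli of its coefficients. Both \<open>f * cnj s\<close> and \<open>s * cnj s\<close>
  integrate to \<open>S\<close>. Integrating the pointwise bound
  \<open>2 * Re (f * cnj s) \<le> B^2 + |s|^2\<close> gives \<open>2 * S \<le> B^2 + S\<close>. Thus
  uniform approximation on the circle implies approximation of the coefficients in norm.\<close>

lemma fourier_bessel:
  assumes meas [measurable]: "f \<in> borel_measurable borel" and B: "\<And>t. cmod (f (cis t)) \<le> B"
  shows fourier_mem_ell2: "fourier f \<in> ell2" and ell2_norm_fourier_le: "ell2_norm (fourier f) \<le> B"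
proof -
  let ?a = "fourier f"
  have B0: "B \<ge> 0" using B[of 0] norm_ge_zero order_trans by blast
  have *: "(\<Sum>n\<in>F. (cmod (?a n))\<^sup>2) \<le> B\<^sup>2" if "finite F" for F
  proof -
    define s where "s t = (\<Sum>n\<in>F. ?a n * cis (of_int n * t))" for t
    define S where "S = (\<Sum>n\<in>F. (cmod (?a n))\<^sup>2)"
    have [measurable]: "s \<in> borel_measurable borel" unfolding s_def by measurable
    have sb: "cmod (s t) \<le> (\<Sum>n\<in>F. cmod (?a n))" for t
      unfolding s_def by (rule order_trans[OF norm_sum]) (simp add: norm_mult)
    have bc: "bounded_circle f" using meas B by (auto simp: bounded_circle_def)
    have cnjs: "cnj (s t) = (\<Sum>n\<in>F. cnj (?a n) * cis (- of_int n * t))" for t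
      by (simp add: s_def cis_cnj)
    have "(\<integral>t. f (cis t) * cnj (s t) \<partial>circle) = (\<integral>t. (\<Sum>n\<in>F. cnj (?a n) * (f (cis t) * cis (- of_int n * t))) \<partial>circle)"
      by (simp add: cnjs sum_distrib_left algebra_simps)
    also have "\<dots> = (\<Sum>n\<in>F. cnj (?a n) * ?a n)"
      unfolding fourier_def using bounded_circle_integrable[OF bc] by (subst Bochner_Integration.integral_sum) auto
    also have "\<dots> = of_real S"
      by (simp add: S_def complex_norm_square mult.commute del: of_real_power)
    finally have fs: "(\<integral>t. f (cis t) * cnj (s t) \<partial>circle) = of_real S" .
    have int_cis: "integrable circle (\<lambda>t. cis (of_int m * t))" for m
      by (rule integrable_circle[where B=1]) auto
    have "(\<integral>t. s t * cnj (s t) \<partial>circle) = (\<integral>t. (\<Sum>n\<in>F. \<Sum>m\<in>F. ?a n * cnj (?a m) * cis (of_int (n - m) * t)) \<partial>circle)"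
      unfolding cnjs unfolding s_def sum_product
      by (intro Bochner_Integration.integral_cong sum.cong) (auto simp: cis_mult algebra_simps)
    also have "\<dots> = (\<Sum>n\<in>F. \<Sum>m\<in>F. ?a n * cnj (?a m) * (if n - m = 0 then 1 else 0))"
      using int_cis
      by (simp add: Bochner_Integration.integral_sum integral_circle_cis del: of_int_diff)
    also have "\<dots> = (\<Sum>n\<in>F. ?a n * cnj (?a n))"
      using that by (simp add: if_distrib[of "\<lambda>x. _ * x"] cong: if_cong)
    also have "\<dots> = of_real S"
      by (simp add: S_def complex_norm_square del: of_real_power)
    finally have ss: "(\<integral>t. s t * cnj (s t) \<partial>circle) = of_real S" .
    have i1: "integrable circle (\<lambda>t. f (cis t) * cnj (s t))"
      by (rule integrable_circle[where B="B * (\<Sum>n\<in>F. cmod (?a n))"])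
        (auto simp: norm_mult B0 intro!: mult_mono B sb)
    have i2: "integrable circle (\<lambda>t. s t * cnj (s t))"
      by (rule integrable_circle[where B="(\<Sum>n\<in>F. cmod (?a n)) * (\<Sum>n\<in>F. cmod (?a n))"])
        (auto simp: norm_mult intro!: mult_mono sb sum_nonneg)
    have "(\<integral>t. 2 * Re (f (cis t) * cnj (s t)) \<partial>circle) \<le> (\<integral>t. B\<^sup>2 + Re (s t * cnj (s t)) \<partial>circle)"
    proof (rule integral_mono)
      show "integrable circle (\<lambda>t. 2 * Re (f (cis t) * cnj (s t)))"
        by (intro integrable_mult_right integrable_Re[OF i1])
      show "integrable circle (\<lambda>t. B\<^sup>2 + Re (s t * cnj (s t)))"
        using integrable_Re[OF i2] by auto
      fix t
      have "2 * Re (f (cis t) * cnj (s t)) \<le> 2 * (cmod (f (cis t)) * cmod (s t))"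
        using complex_Re_le_cmod[of "f (cis t) * cnj (s t)"] by (simp add: norm_mult)
      also have "\<dots> \<le> (cmod (f (cis t)))\<^sup>2 + (cmod (s t))\<^sup>2"
        using sum_squares_bound[of "cmod (f (cis t))" "cmod (s t)"] by simp
      also have "\<dots> \<le> B\<^sup>2 + (cmod (s t))\<^sup>2" using B by (simp add: power_mono)
      also have "(cmod (s t))\<^sup>2 = Re (s t * cnj (s t))"
        by (simp add: complex_mult_cnj cmod_power2)
      finally show "2 * Re (f (cis t) * cnj (s t)) \<le> B\<^sup>2 + Re (s t * cnj (s t))" .
    qed
    moreover have "(\<integral>t. 2 * Re (f (cis t) * cnj (s t)) \<partial>circle) = 2 * S"
      unfolding integral_mult_right_zero integral_Re[OF i1] fs by simp
    moreover have "(\<integral>t. B\<^sup>2 + Re (s t * cnj (s t)) \<partial>circle) = B\<^sup>2 + S"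
      using integral_Re[OF i2] integrable_Re[OF i2] ss
      by (subst Bochner_Integration.integral_add) auto
    ultimately show ?thesis by (simp add: S_def)
  qed
  from ell2_boundI[OF * B0] show "fourier f \<in> ell2" "ell2_norm (fourier f) \<le> B" by auto
qed

lemma pred_funpow: "((\<lambda>n::int. n - 1) ^^ m) n = n - int m"
  by (induction m) auto

text \<open>The coefficient of \<open>z^m * f\<close> at \<open>n\<close> is that of
  \<open>f\<close> at \<open>n - m\<close>, so multiplication by the variable becomes the bilateral
  shift, which is composition with \<open>n - 1\<close>.\<close>

lemma fourier_poly_mult:
  assumes "bounded_circle f"
  shows "fourier (\<lambda>z. (\<Sum>m<N. c m * z ^ m) * f z) = poly_comp (\<lambda>n. n - 1) N c (fourier f)"
proof
  fix n
  have "fourier (\<lambda>z. (\<Sum>m<N. c m * z ^ m) * f z) n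
      = (\<integral>t. (\<Sum>m<N. c m * (f (cis t) * cis (- of_int (n - int m) * t))) \<partial>circle)"
    unfolding fourier_def sum_distrib_right
  proof (intro Bochner_Integration.integral_cong sum.cong refl)
    fix t m
    have "cis t ^ m * cis (- of_int n * t) = cis (- of_int (n - int m) * t)"
      unfolding Complex.DeMoivre cis_mult by (simp add: algebra_simps)
    then show "c m * cis t ^ m * f (cis t) * cis (- of_int n * t) = c m * (f (cis t) * cis (- of_int (n - int m) * t))"
      by (metis mult.assoc mult.commute)
  qed
  also have "\<dots> = (\<Sum>m<N. c m * fourier f (n - int m))"
    unfolding fourier_def
    by (subst Bochner_Integration.integral_sum, intro integrable_mult_right bounded_circle_integrable[OF assms]) simp
  finally show "fourier (\<lambda>z. (\<Sum>m<N. c m * z ^ m) * f z) n = poly_comp (\<lambda>n. n - 1) N c (fourier f) n"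
    by (simp add: poly_comp_def pred_funpow)
qed

lemma fourier_diff:
  assumes "bounded_circle f" "bounded_circle g"
  shows "fourier (\<lambda>z. f z - g z) = (\<lambda>n. fourier f n - fourier g n)"
  unfolding fourier_def using bounded_circle_integrable[OF assms(1)] bounded_circle_integrable[OF assms(2)]
  by (auto simp: left_diff_distrib)

lemma fourier_one_plus: "fourier (\<lambda>z. 1 + z) = (\<lambda>n. basis_vec 0 n + basis_vec 1 n)"
proof
  fix n
  have int_cis: "integrable circle (\<lambda>t. cis (of_int m * t))" for m
    by (rule integrable_circle[where B=1]) auto
  have "fourier (\<lambda>z. 1 + z) n = (\<integral>t. cis (of_int (- n) * t) + cis (of_int (1 - n) * t) \<partial>circle)"
    unfolding fourier_def by (intro Bochner_Integration.integral_cong) (auto simp: cis_mult algebra_simps)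
  also have "\<dots> = (if - n = 0 then 1 else 0) + (if 1 - n = 0 then 1 else 0)"
    using int_cis by (subst Bochner_Integration.integral_add) (auto simp: integral_circle_cis simp del: of_int_minus of_int_diff)
  finally show "fourier (\<lambda>z. 1 + z) n = basis_vec 0 n + basis_vec 1 n"
    by (auto simp: basis_vec_def)
qed

text \<open>The Taylor series at 0 converges uniformly on the closed disc of radius
  \<open>r\<close>. The dilation avoids boundary values of \<open>F\<close>, which may be singular
  at -1; the conditions on \<open>N\<close> and \<open>c 0\<close> preserve the constant
  term.\<close>

lemma holomorphic_dilate_poly_approx:
  assumes "F holomorphic_on ball 0 1" "0 < r" "r < 1" "e > 0"
  obtains N c where "0 < N" "c 0 = F 0" "\<And>z. cmod z = 1 \<Longrightarrow> cmod (F (of_real r * z) - (\<Sum>m<N. c m * z ^ m)) < e"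
proof -
  define a where "a n = (deriv ^^ n) F 0 / fact n" for n
  have sums: "(\<lambda>n. a n * w ^ n) sums F w" if "w \<in> ball 0 1" for w
    using holomorphic_power_series[OF assms(1) that] by (simp add: a_def)
  \<comment> \<open>A point strictly between \<open>r\<close> and 1: convergence there forces a
    radius of convergence greater than \<open>r\<close>.\<close>
  define \<rho> where "\<rho> = (1 + r) / 2"
  have \<rho>: "r < \<rho>" "\<rho> < 1" using assms by (auto simp: \<rho>_def)
  have "summable (\<lambda>n. a n * of_real \<rho> ^ n)"
    using sums[of "of_real \<rho>"] assms(2) \<rho> by (auto simp: sums_iff)
  then have "ereal \<rho> \<le> conv_radius a"
    using conv_radius_geI[of a "of_real \<rho>"] assms(2) \<rho> by simp
  then have "ereal r < conv_radius a" using \<rho>(1) by (meson less_ereal.simps(1) less_le_trans)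
  then have "uniform_limit (cball 0 r) (\<lambda>n x. \<Sum>i<n. a i * (x - 0) ^ i) (\<lambda>x. suminf (\<lambda>i. a i * (x - 0) ^ i)) sequentially"
    by (rule powser_uniform_limit)
  then have "\<forall>\<^sub>F n in sequentially. \<forall>x\<in>cball 0 r. dist (\<Sum>i<n. a i * (x - 0) ^ i) (suminf (\<lambda>i. a i * (x - 0) ^ i)) < e"
    using assms(4) unfolding uniform_limit_iff by blast
  then have "\<forall>\<^sub>F n in sequentially. n > 0 \<and> (\<forall>x\<in>cball 0 r. dist (\<Sum>i<n. a i * (x - 0) ^ i) (suminf (\<lambda>i. a i * (x - 0) ^ i)) < e)"
    by (intro eventually_conj eventually_gt_at_top)
  then obtain N where N: "N > 0" "\<And>x. x \<in> cball 0 r \<Longrightarrow> dist (\<Sum>i<N. a i * x ^ i) (suminf (\<lambda>i. a i * x ^ i)) < e"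
    by (auto dest!: eventually_happens)
  show ?thesis
  \<comment> \<open>Putting the powers of \<open>r\<close> into the coefficients turns the truncated
    series at \<open>r * z\<close> into a polynomial in \<open>z\<close>.\<close>
  proof (rule that[of N "\<lambda>m. a m * of_real r ^ m"])
    fix z :: complex assume z: "cmod z = 1"
    let ?w = "of_real r * z"
    have "cmod ?w = r" using z assms by (simp add: norm_mult)
    then have "?w \<in> ball 0 1" "?w \<in> cball 0 r" using assms by auto
    then have "dist (\<Sum>i<N. a i * ?w ^ i) (F ?w) < e"
      using N(2)[of ?w] sums[of ?w] by (simp add: sums_iff)
    then show "cmod (F ?w - (\<Sum>m<N. a m * of_real r ^ m * z ^ m)) < e"
      by (simp add: dist_norm norm_minus_commute power_mult_distrib mult.assoc)
  qed (use N in \<open>auto simp: a_def\<close>)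
qed

section \<open>The weight on the circle\<close>

text \<open>The value 0 at -1 is the limit along the circle. It is set separately because division
  by zero would make the exponent 0 and the value 1.\<close>

definition weight :: "complex \<Rightarrow> complex" where
  "weight z = (if z = -1 then 0 else of_real (exp (- 1 / (cmod (1 + z))\<^sup>2)))"

lemma borel_measurable_weight [measurable]: "weight \<in> borel_measurable borel"
  unfolding weight_def by measurable

lemma norm_weight_le: "cmod (weight z) \<le> 1"
  by (simp add: weight_def)

text \<open>Both sides equal \<open>1 + 2 * r * Re z + r^2\<close>. For \<open>r > 0\<close> it
  yields the lower bound \<open>r * |1 + z|^2\<close>, on which both approximation lemmas for the
  weight rest.\<close>

lemma cmod_one_plus_dilate:
  assumes "cmod z = 1"
  shows "(cmod (1 + of_real r * z))\<^sup>2 = (1 - r)\<^sup>2 + r * (cmod (1 + z))\<^sup>2"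
proof -
  have "(Re z)\<^sup>2 + (Im z)\<^sup>2 = 1" using assms by (metis cmod_power2 one_power2)
  then have "c * (Re z)\<^sup>2 + c * (Im z)\<^sup>2 = c" for c
    by (metis distrib_left mult.right_neutral)
  from this[of r] this[of "r\<^sup>2"] this[of 1]
  show ?thesis
    unfolding cmod_power2 by (simp add: power2_eq_square algebra_simps)
qed

text \<open>Apart from the factor \<open>exp (-n)\<close>, the function \<open>F\<close> is a power
  of the reciprocal of the atomic singular inner function with mass at -1. Its growth near -1 is
  absorbed by the weight, provided the dilation is matched to \<open>n\<close>.\<close>

lemma weight_annihilated:
  assumes "e > 0"
  obtains N c where "0 < N" "c 0 = 1" "\<And>z. cmod z = 1 \<Longrightarrow> cmod ((\<Sum>m<N. c m * z ^ m) * weight z) \<le> e"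
proof -
  obtain n0 :: nat where n0: "inverse (real (Suc n0)) < e/2"
    using reals_Archimedean[of "e/2"] assms by auto
  define n where "n = real (Suc n0)"
  have n: "n > 0" "exp (- n) < e/2"
  proof -
    have "exp (- n) = inverse (exp n)" by (simp add: exp_minus)
    also have "\<dots> \<le> inverse n"
      using exp_ge_add_one_self[of n] by (intro le_imp_inverse_le) (auto simp: n_def)
    finally show "exp (- n) < e/2" using n0 by (simp add: n_def)
  qed (simp add: n_def)
  \<comment> \<open>The choice makes \<open>2 * n * (1 - r) = r\<close>. Hence
    \<open>n * (1 - r^2) \<le> r\<close>, and dividing by \<open>D \<ge> r * s^2\<close> leaves at
    most \<open>1 / s^2\<close>, exactly the exponent that the weight cancels.\<close>
  define r where "r = 2 * n / (2 * n + 1)"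
  have r: "0 < r" "r < 1" "2 * n * (1 - r) = r" using n by (auto simp: r_def field_simps)
  define F where "F w = exp (- (of_real (2 * n) * w / (1 + w)))" for w :: complex
  have nz: "1 + w \<noteq> 0" if "cmod w < 1" for w
    using that by (metis add_eq_0_iff2 norm_minus_cancel norm_one order_less_irrefl)
  have "F holomorphic_on ball 0 1"
    unfolding F_def using nz by (intro holomorphic_intros) auto
  then obtain N c where c: "0 < N" "c 0 = F 0"
      "\<And>z. cmod z = 1 \<Longrightarrow> cmod (F (of_real r * z) - (\<Sum>m<N. c m * z ^ m)) < e/2"
    using holomorphic_dilate_poly_approx[of F r "e/2"] r assms by (metis half_gt_zero)
  have main: "cmod (F (of_real r * z) * weight z) \<le> exp (- n)" if z: "cmod z = 1" for z
  proof (cases "z = -1")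
    case False
    define s where "s = cmod (1 + z)"
    have s: "s > 0" using False by (auto simp: s_def add_eq_0_iff)
    let ?w = "of_real r * z"
    have w: "cmod ?w = r" using z r by (simp add: norm_mult)
    define D where "D = (cmod (1 + ?w))\<^sup>2"
    have D: "D = (1 - r)\<^sup>2 + r * s\<^sup>2" unfolding D_def s_def by (rule cmod_one_plus_dilate[OF z])
    have w0: "1 + ?w \<noteq> 0" using nz w r by simp
    \<comment> \<open>The Cayley transform is split off, since its real part is the explicit
      quotient \<open>(1 - |w|^2) / |1 + w|^2\<close>.\<close>
    have "- (of_real (2 * n) * ?w / (1 + ?w)) = of_real n * ((1 - ?w) / (1 + ?w)) - of_real n"
      using w0 by (simp add: divide_simps) (simp add: algebra_simps)
    moreover have "Re ((1 - ?w) / (1 + ?w)) = (1 - r\<^sup>2) / D"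
    proof -
      have "(Re ?w)\<^sup>2 + (Im ?w)\<^sup>2 = r\<^sup>2" using w by (metis cmod_power2)
      moreover have "Re ((1 - v) / (1 + v)) = (1 - ((Re v)\<^sup>2 + (Im v)\<^sup>2)) / (cmod (1 + v))\<^sup>2" for v
        unfolding Re_divide cmod_power2 by (simp add: power2_eq_square algebra_simps)
      ultimately show ?thesis by (simp add: D_def)
    qed
    ultimately have Re: "Re (- (of_real (2 * n) * ?w / (1 + ?w))) = n * ((1 - r\<^sup>2) / D) - n"
      by (simp only: minus_complex.simps times_complex.simps Re_complex_of_real Im_complex_of_real mult_zero_left diff_zero)
    have "n * (1 - r\<^sup>2) \<le> 2 * n * (1 - r)"
    proof -
      have "n * (1 - r\<^sup>2) = n * (1 - r) * (1 + r)" by (simp add: power2_eq_square algebra_simps)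
      also have "\<dots> \<le> n * (1 - r) * 2" using r(1,2) n(1) by (intro mult_left_mono) auto
      finally show ?thesis by (simp add: mult_ac)
    qed
    then have "n * ((1 - r\<^sup>2) / D) \<le> r / D"
      using r(3) D r s by (simp add: divide_right_mono)
    also have "\<dots> \<le> r / (r * s\<^sup>2)"
      using D r s by (intro divide_left_mono) (auto intro!: mult_pos_pos add_nonneg_pos)
    also have "\<dots> = 1 / s\<^sup>2" using r by simp
    finally have "Re (- (of_real (2 * n) * ?w / (1 + ?w))) - 1 / s\<^sup>2 \<le> - n"
      unfolding Re by simp
    moreover have "cmod (F ?w * weight z) = exp (Re (- (of_real (2 * n) * ?w / (1 + ?w))) - 1 / s\<^sup>2)"
      using False by (simp only: norm_mult F_def norm_exp_eq_Re weight_def s_def if_False norm_of_real abs_exp_cancel exp_add[symmetric]) simp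
    ultimately show ?thesis by simp
  qed (simp add: weight_def)
  show ?thesis
  proof (rule that[OF c(1)])
    show "c 0 = 1" using c(2) by (simp add: F_def)
    fix z :: complex assume z: "cmod z = 1"
    let ?p = "\<Sum>m<N. c m * z ^ m"
    have "?p * weight z = F (of_real r * z) * weight z - (F (of_real r * z) - ?p) * weight z"
      by (simp add: algebra_simps)
    then have "cmod (?p * weight z) \<le> cmod (F (of_real r * z) * weight z) + cmod ((F (of_real r * z) - ?p) * weight z)"
      using norm_triangle_ineq4 by simp
    also have "\<dots> \<le> exp (- n) + cmod (F (of_real r * z) - ?p) * 1"
      using main[OF z] norm_weight_le[of z] unfolding norm_mult by (intro add_mono mult_left_mono) auto
    also have "\<dots> \<le> e" using n(2) c(3)[OF z] by linarith
    finally show "cmod (?p * weight z) \<le> e" .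
  qed
qed

text \<open>The dilate of \<open>F\<close> times the weight is \<open>(1 + z) * exp X\<close> with
  \<open>Re X \<le> 0\<close>. Near -1 the factor \<open>1 + z\<close> is small and
  \<open>exp X\<close> is bounded; elsewhere \<open>X\<close> tends to 0 as \<open>r\<close> tends
  to 1. The factor \<open>1 + z\<close> is what allows an approximation at the zero of the
  weight.\<close>

lemma weight_reaches_one_plus:
  assumes "e > 0"
  obtains N c where "\<And>z. cmod z = 1 \<Longrightarrow> cmod ((1 + z) - (\<Sum>m<N. c m * z ^ m) * weight z) \<le> e"
proof -
  \<comment> \<open>\<open>d\<close> separates the arc near -1 from the rest. The bounds on
    \<open>\<delta>\<close> give in turn \<open>r \<ge> 1/2\<close>, \<open>|X| \<le> 1\<close> and
    \<open>|X| \<le> e/12\<close> away from -1.\<close>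
  define d where "d = e / 4"
  have d: "d > 0" using assms by (simp add: d_def)
  define \<delta> where "\<delta> = min (1/2) (min (d^4 / 4) (e * d^4 / 48))"
  have \<delta>: "0 < \<delta>" "\<delta> \<le> 1/2" "\<delta> \<le> d^4 / 4" "\<delta> \<le> e * d^4 / 48" using d assms by (auto simp: \<delta>_def)
  define r where "r = 1 - \<delta>"
  have r: "1/2 \<le> r" "0 < r" "r < 1" using \<delta> by (auto simp: r_def)
  define G where "G w = exp (w / (1 + w)\<^sup>2)" for w :: complex
  \<comment> \<open>Dividing by \<open>r\<close> makes this factor exactly \<open>1 + z\<close>
    after the dilation.\<close>
  define F where "F w = (1 + w / of_real r) * G w" for w :: complex
  have nz: "1 + w \<noteq> 0" if "cmod w < 1" for w
    using that by (metis add_eq_0_iff2 norm_minus_cancel norm_one order_less_irrefl)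
  have "F holomorphic_on ball 0 1"
    unfolding F_def G_def using nz r by (intro holomorphic_intros) auto
  then obtain N c where c: 
      "\<And>z. cmod z = 1 \<Longrightarrow> cmod (F (of_real r * z) - (\<Sum>m<N. c m * z ^ m)) < e/2"
    using holomorphic_dilate_poly_approx[of F r "e/2"] r assms by (metis half_gt_zero)
  have main: "cmod ((1 + z) - F (of_real r * z) * weight z) \<le> e/2" if z: "cmod z = 1" for z
  proof (cases "z = -1")
    case False
    define s where "s = cmod (1 + z)"
    have s: "s > 0" using False by (auto simp: s_def add_eq_0_iff)
    have s2: "s \<le> 2" using norm_triangle_ineq[of 1 z] z by (simp add: s_def)
    let ?w = "of_real r * z"
    have w: "cmod ?w = r" using z r by (simp add: norm_mult)
    have w0: "1 + ?w \<noteq> 0" using nz w r by simp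
    have z0: "1 + z \<noteq> 0" using False by (simp add: add_eq_0_iff)
    have D: "(cmod (1 + ?w))\<^sup>2 = (1 - r)\<^sup>2 + r * s\<^sup>2" unfolding s_def by (rule cmod_one_plus_dilate[OF z])
    \<comment> \<open>A rotated Koebe function, positive on the circle away from -1 because
      \<open>(1 + z)^2 = z * |1 + z|^2\<close> there. So the weight is the boundary value of
      \<open>1 / G\<close>.\<close>
    have koebe: "z / (1 + z)\<^sup>2 = of_real (1 / s\<^sup>2)"
    proof -
      have "z * cnj z = 1" using z by (simp add: complex_mult_cnj cmod_def)
      then have "z * ((1 + z) * cnj (1 + z)) = (1 + z)\<^sup>2"
        by (simp add: power2_eq_square algebra_simps)
      then have "z * of_real (s\<^sup>2) = (1 + z)\<^sup>2" by (simp only: s_def complex_norm_square)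
      then show ?thesis using s z0 by (simp add: field_simps)
    qed
    define X where "X = ?w / (1 + ?w)\<^sup>2 - z / (1 + z)\<^sup>2"
    have "weight z = exp (- (z / (1 + z)\<^sup>2))"
      unfolding koebe using False by (simp add: weight_def s_def exp_of_real[symmetric])
    then have GX: "G ?w * weight z = exp X"
      by (simp add: X_def G_def exp_diff exp_minus divide_inverse)
    \<comment> \<open>The dilated Koebe value has modulus at most \<open>1 / s^2\<close>, hence
      \<open>|exp X| \<le> 1\<close> on the whole circle, however close to -1.\<close>
    have "Re (?w / (1 + ?w)\<^sup>2) \<le> cmod (?w / (1 + ?w)\<^sup>2)" by (rule complex_Re_le_cmod)
    also have "\<dots> = r / ((1 - r)\<^sup>2 + r * s\<^sup>2)" by (simp only: norm_divide norm_power w D)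
    also have "\<dots> \<le> r / (r * s\<^sup>2)" using r s by (intro divide_left_mono) (auto intro!: mult_pos_pos add_nonneg_pos)
    finally have ReX: "Re X \<le> 0" using r by (simp add: X_def koebe)
    have "cmod (1 + z - F ?w * weight z) = s * cmod (1 - exp X)"
      using GX r by (simp add: F_def s_def norm_mult[symmetric] algebra_simps)
    also have "\<dots> \<le> e / 2"
    proof (cases "s \<le> d")
      case True
      have "cmod (1 - exp X) \<le> 2"
      proof -
        have "exp (Re X) \<le> 1" using ReX by simp
        then show ?thesis
          using norm_triangle_ineq4[of 1 "exp X"] unfolding norm_exp_eq_Re norm_one by linarith
      qed
      then have "s * cmod (1 - exp X) \<le> d * 2" using True s by (intro mult_mono) auto
      then show ?thesis by (simp add: d_def)
    next
      case sd: False
      \<comment> \<open>Over a common denominator the numerator has the factor \<open>1 - r\<close>,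
        which makes \<open>X\<close> small where \<open>s\<close> is bounded below.\<close>
      have "X = of_real (1 - r) * z * (of_real r * z\<^sup>2 - 1) / ((1 + ?w)\<^sup>2 * (1 + z)\<^sup>2)"
      proof -
        have "X = (?w * (1 + z)\<^sup>2 - z * (1 + ?w)\<^sup>2) / ((1 + ?w)\<^sup>2 * (1 + z)\<^sup>2)"
          unfolding X_def using w0 z0 by (intro diff_frac_eq) auto
        also have "?w * (1 + z)\<^sup>2 - z * (1 + ?w)\<^sup>2 = of_real (1 - r) * z * (of_real r * z\<^sup>2 - 1)"
          by (simp add: power2_eq_square algebra_simps)
        finally show ?thesis .
      qed
      then have "cmod X = (1 - r) * cmod (of_real r * z\<^sup>2 - 1) / ((cmod (1 + ?w))\<^sup>2 * s\<^sup>2)"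
        using z r by (simp add: norm_mult norm_divide norm_power s_def del: of_real_diff)
      also have "\<dots> \<le> (1 - r) * 2 / ((r * s\<^sup>2) * s\<^sup>2)"
      proof (intro frac_le mult_left_mono mult_right_mono mult_nonneg_nonneg)
        show "cmod (of_real r * z\<^sup>2 - 1) \<le> 2"
          using norm_triangle_ineq4[of "of_real r * z\<^sup>2" 1] z r by (simp add: norm_mult norm_power)
      qed (use r s D in auto)
      also have "\<dots> \<le> \<delta> * 2 / ((1/2 * d\<^sup>2) * d\<^sup>2)"
        using r sd d s by (intro frac_le mult_mono power_mono) (auto simp: r_def)
      also have "\<dots> = 4 * \<delta> / d^4" by (simp add: power2_eq_square power4_eq_xxxx)
      finally have X: "cmod X \<le> 4 * \<delta> / d^4" .
      have X1: "cmod X \<le> 1"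
        by (rule order_trans[OF X]) (use \<delta> d in \<open>simp add: field_simps\<close>)
      have X2: "cmod X \<le> e / 12"
        by (rule order_trans[OF X]) (use \<delta> d in \<open>simp add: field_simps\<close>)
      \<comment> \<open>Taylor's formula of order 0; with \<open>exp 1 \<le> 3\<close> and
        \<open>s \<le> 2\<close> the total is at most \<open>e/2\<close>.\<close>
      have "cmod (exp X - 1) \<le> exp \<bar>Re X\<bar> * cmod X"
        using Taylor_exp[of X 0] by simp
      also have "\<dots> \<le> exp 1 * (e/12)"
        using X1 X2 abs_Re_le_cmod[of X] by (intro mult_mono) auto
      also have "\<dots> \<le> 3 * (e/12)" using exp_le assms by (intro mult_right_mono) auto
      finally have "cmod (1 - exp X) \<le> e/4" by (simp add: norm_minus_commute)
      then have "s * cmod (1 - exp X) \<le> 2 * (e/4)" using s s2 by (intro mult_mono) auto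
      then show ?thesis by simp
    qed
    finally show ?thesis .
  qed (use assms in \<open>simp add: weight_def\<close>)
  show ?thesis
  proof (rule that)
    fix z :: complex assume z: "cmod z = 1"
    let ?p = "\<Sum>m<N. c m * z ^ m"
    have "(1 + z) - ?p * weight z = ((1 + z) - F (of_real r * z) * weight z) + (F (of_real r * z) - ?p) * weight z"
      by (simp add: algebra_simps)
    then have "cmod ((1 + z) - ?p * weight z) \<le> cmod ((1 + z) - F (of_real r * z) * weight z) + cmod ((F (of_real r * z) - ?p) * weight z)"
      using norm_triangle_ineq by metis
    also have "\<dots> \<le> e/2 + cmod (F (of_real r * z) - ?p) * 1"
      using main[OF z] norm_weight_le[of z] unfolding norm_mult by (intro add_mono mult_left_mono) auto
    also have "\<dots> \<le> e" using c[OF z] by linarith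
    finally show "cmod ((1 + z) - ?p * weight z) \<le> e" .
  qed
qed

section \<open>Cyclicity of the bilateral shift\<close>

interpretation bilateral: inj_comp "\<lambda>n::int. n - 1"
  by standard (auto intro: injI)

lemma bounded_circle_weight: "bounded_circle weight"
  using norm_weight_le by (auto simp: bounded_circle_def)

lemma fourier_weight_ell2: "fourier weight \<in> ell2"
  using norm_weight_le by (intro fourier_mem_ell2[where B=1]) auto

abbreviation weight_space :: "(int \<Rightarrow> complex) set" where
  "weight_space \<equiv> cyclic_space (\<lambda>n::int. n - 1) (fourier weight)"

text \<open>The inverse of the bilateral shift, which the nonnegative powers treated in
  \<open>inj_comp\<close> do not include.\<close>

lemma ell2_succ:
  assumes "f \<in> ell2"
  shows ell2_succ_mem: "(\<lambda>n::int. f (n + 1)) \<in> ell2" and ell2_norm_succ_le: "ell2_norm (\<lambda>n::int. f (n + 1)) \<le> ell2_norm f"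
  using assms by (auto intro!: ell2_reindex[where \<sigma>="\<lambda>n. n + 1" and f=f] inj_onI)

lemma fourier_weight_annihilated:
  assumes "e > 0"
  obtains N c where "0 < N" "c 0 = 1" "ell2_norm (poly_comp (\<lambda>n. n - 1) N c (fourier weight)) \<le> e"
proof -
  obtain N c where c: "0 < N" "c 0 = 1" "\<And>z. cmod z = 1 \<Longrightarrow> cmod ((\<Sum>m<N. c m * z ^ m) * weight z) \<le> e"
    using weight_annihilated[OF assms] by blast
  have "ell2_norm (poly_comp (\<lambda>n. n - 1) N c (fourier weight)) \<le> e"
    using c(3) by (subst fourier_poly_mult[OF bounded_circle_weight, symmetric], intro ell2_norm_fourier_le) auto
  with c that show ?thesis by blast
qed

text \<open>Since \<open>c 0 = 1\<close>, applying the inverse shift to the small vector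
  \<open>p(S) g\<close> shows that \<open>S^(-1) g\<close> nearly equals minus a polynomial in
  \<open>S\<close> applied to \<open>g\<close>.\<close>

lemma fourier_weight_succ: "(\<lambda>n. fourier weight (n + 1)) \<in> weight_space"
proof (rule bilateral.cyclic_spaceI)
  let ?g = "fourier weight"
  fix e :: real assume e: "e > 0"
  then have "e/2 > 0" by simp
  then obtain N c where c: "0 < N" "c 0 = 1" "ell2_norm (poly_comp (\<lambda>n. n - 1) N c ?g) \<le> e/2"
    using fourier_weight_annihilated by blast
  then obtain M where M: "N = Suc M" by (cases N) auto
  let ?q = "poly_comp (\<lambda>n. n - 1) N c ?g"
  have "ell2_norm (\<lambda>n. ?q (n + 1)) < e"
    using ell2_norm_succ_le[OF bilateral.poly_comp_mem[OF fourier_weight_ell2], of N c] c(3) e by linarith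
  moreover let ?h = "poly_comp (\<lambda>n. n - 1) M (\<lambda>m. - c (Suc m)) ?g"
  have "?q (n + 1) = ?g (n + 1) - ?h n" for n
    unfolding poly_comp_def M sum.lessThan_Suc_shift pred_funpow by (simp add: c(2) sum_negf)
  ultimately have "ell2_norm (\<lambda>n. ?g (n + 1) - ?h n) < e" by simp
  then show "\<exists>h\<in>weight_space. ell2_norm (\<lambda>n. ?g (n + 1) - h n) < e"
    using bilateral.cyclic_space_poly_comp[OF fourier_weight_ell2] by blast
qed (auto intro: ell2_succ_mem fourier_weight_ell2)

text \<open>The inverse shift commutes with polynomials in \<open>S\<close>, so the case of the
  generator suffices.\<close>

lemma weight_space_succ:
  assumes "f \<in> weight_space"
  shows "(\<lambda>n. f (n + 1)) \<in> weight_space"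
proof (rule bilateral.cyclic_spaceI)
  let ?g = "fourier weight"
  have f: "f \<in> ell2" using assms by (rule bilateral.cyclic_space_ell2)
  then show "(\<lambda>n. f (n + 1)) \<in> ell2" by (rule ell2_succ_mem)
  fix e :: real assume "e > 0"
  then obtain N c where c: "ell2_norm (\<lambda>n. f n - poly_comp (\<lambda>n. n - 1) N c ?g n) < e"
    using assms by (auto simp: cyclic_space_def)
  have eq: "poly_comp (\<lambda>n. n - 1) N c ?g (n + 1) = poly_comp (\<lambda>n. n - 1) N c (\<lambda>n. ?g (n + 1)) n" for n
    by (simp add: poly_comp_def pred_funpow algebra_simps)
  have "ell2_norm (\<lambda>n. f (n + 1) - poly_comp (\<lambda>n. n - 1) N c (\<lambda>n. ?g (n + 1)) n) < e"
    using ell2_norm_succ_le[OF ell2_diff_mem[OF f bilateral.poly_comp_mem[OF fourier_weight_ell2]], of N c] c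
    by (simp add: eq)
  then show "\<exists>h\<in>weight_space. ell2_norm (\<lambda>n. f (n + 1) - h n) < e"
    using bilateral.cyclic_space_poly_comp_mem[OF fourier_weight_succ fourier_weight_ell2] by blast
qed (rule fourier_weight_ell2)

lemma basis_pair_weight_space: "(\<lambda>n. basis_vec 0 n + basis_vec 1 n) \<in> weight_space"
proof (rule bilateral.cyclic_spaceI)
  let ?g = "fourier weight"
  fix e :: real assume e: "e > 0"
  then have "e/2 > 0" by simp
  then obtain N c where c: "\<And>z. cmod z = 1 \<Longrightarrow> cmod ((1 + z) - (\<Sum>m<N. c m * z ^ m) * weight z) \<le> e/2"
    by (rule weight_reaches_one_plus) blast
  let ?p = "\<lambda>z. (\<Sum>m<N. c m * z ^ m) * weight z"
  have 1: "bounded_circle (\<lambda>z. 1 + z)"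
    unfolding bounded_circle_def by (auto intro!: exI[of _ 2] order_trans[OF norm_triangle_ineq])
  have 2: "bounded_circle ?p"
    unfolding bounded_circle_def
  proof (intro conjI exI allI)
    show "?p \<in> borel_measurable borel" by measurable
    fix t
    have "cmod (?p (cis t)) \<le> (\<Sum>m<N. cmod (c m)) * 1"
      unfolding norm_mult
      by (intro mult_mono norm_weight_le order_trans[OF norm_sum]) (auto simp: norm_mult norm_power sum_nonneg)
    then show "cmod (?p (cis t)) \<le> (\<Sum>m<N. cmod (c m))" by simp
  qed
  have "ell2_norm (fourier (\<lambda>z. (1 + z) - ?p z)) \<le> e/2"
    using c by (intro ell2_norm_fourier_le) auto
  then have "ell2_norm (\<lambda>n. (basis_vec 0 n + basis_vec 1 n) - poly_comp (\<lambda>n. n - 1) N c ?g n) < e"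
    unfolding fourier_diff[OF 1 2] fourier_one_plus fourier_poly_mult[OF bounded_circle_weight]
    using e by simp
  then show "\<exists>h\<in>weight_space. ell2_norm (\<lambda>n. (basis_vec 0 n + basis_vec 1 n) - h n) < e"
    using bilateral.cyclic_space_poly_comp[OF fourier_weight_ell2] by blast
qed (auto intro: ell2_add_mem basis_vec_ell2 fourier_weight_ell2)

text \<open>Telescoping the pairs reaches \<open>e\<^sub>0 \<plusminus> e\<^sub>N\<close> for every \<open>N \<ge> 1\<close>, and averaging over \<open>N\<close> removes the second term.\<close>

lemma basis_zero_weight_space: "basis_vec 0 \<in> weight_space"
proof (rule bilateral.cyclic_spaceI)
  note g = fourier_weight_ell2
  have shift: "basis_vec (0::int) (n - int m) + basis_vec 1 (n - int m) = basis_vec (int m) n + basis_vec (int m + 1) n" for n m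
    by (auto simp: basis_vec_def)
  have pair: "(\<lambda>n. basis_vec (int m) n + basis_vec (int m + 1) n) \<in> weight_space" for m
    using bilateral.cyclic_space_comp[OF basis_pair_weight_space g, of m] unfolding pred_funpow shift .
  have tele: "(\<lambda>n. basis_vec 0 n - (-1) ^ m * basis_vec (int m) n) \<in> weight_space" for m
  proof (induction m)
    case 0
    show ?case using bilateral.cyclic_space_zero[OF g] by simp
  next
    case (Suc m)
    have "(\<lambda>n. (basis_vec 0 n - (-1) ^ m * basis_vec (int m) n) + (-1) ^ m * (basis_vec (int m) n + basis_vec (int m + 1) n)) \<in> weight_space"
      by (rule bilateral.cyclic_space_add[OF Suc bilateral.cyclic_space_scale[OF pair g] g])
    then show ?case by (simp add: algebra_simps)
  qed
  fix e :: real assume e: "e > 0"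
  obtain M :: nat where M: "M > 0" "inverse (real M) < e\<^sup>2"
    using reals_Archimedean[of "e\<^sup>2"] e by (metis zero_less_power zero_less_Suc)
  let ?h = "\<lambda>n. (1 / of_nat M) * (\<Sum>m<M. basis_vec 0 n - (-1) ^ m * basis_vec (int m) n)"
  have h: "?h \<in> weight_space"
    by (intro bilateral.cyclic_space_scale bilateral.cyclic_space_sum tele g)
  \<comment> \<open>The error of the average has \<open>M\<close> entries of modulus
    \<open>1 / M\<close>, hence norm \<open>1 / sqrt M\<close>; this explains the choice
    \<open>1 / M < e^2\<close>.\<close>
  have eq: "basis_vec 0 n - ?h n = (if n \<in> {0..<int M} then (-1) ^ nat n / of_nat M else 0)" for n
  proof -
    have "(\<Sum>m<M. (-1) ^ m * basis_vec (int m) n) = (\<Sum>m<M. if m = nat n \<and> n \<ge> 0 then (-1) ^ m else (0::complex))"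
      by (intro sum.cong) (auto simp: basis_vec_def)
    also have "\<dots> = (if n \<in> {0..<int M} then (-1) ^ nat n else 0)"
      by (cases "n \<ge> 0") auto
    finally show ?thesis using M(1) by (simp add: sum_subtractf divide_simps)
  qed
  have "ell2_norm (\<lambda>n. basis_vec 0 n - ?h n) \<le> sqrt (inverse (real M))"
  proof (rule ell2_norm_leI)
    fix F :: "int set" assume F: "finite F"
    have "(\<Sum>n\<in>F. (cmod (basis_vec 0 n - ?h n))\<^sup>2) = (\<Sum>n\<in>F. if n \<in> {0..<int M} then (1 / real M)\<^sup>2 else 0)"
      unfolding eq by (intro sum.cong) (auto simp: norm_divide norm_power)
    also have "\<dots> = (\<Sum>n\<in>F \<inter> {0..<int M}. (1 / real M)\<^sup>2)"
      using F by (rule sum.inter_restrict[symmetric])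
    also have "\<dots> \<le> (\<Sum>n\<in>{0..<int M}. (1 / real M)\<^sup>2)"
      by (intro sum_mono2) auto
    also have "\<dots> = inverse (real M)" using M(1) by (simp add: power2_eq_square field_simps)
    finally show "(\<Sum>n\<in>F. (cmod (basis_vec 0 n - ?h n))\<^sup>2) \<le> (sqrt (inverse (real M)))\<^sup>2" by simp
  qed simp
  also have "\<dots> < e" using M e by (intro real_less_lsqrt) auto
  finally show "\<exists>h\<in>weight_space. ell2_norm (\<lambda>n. basis_vec 0 n - h n) < e" by (rule bexI[OF _ h])
qed (auto intro: basis_vec_ell2 fourier_weight_ell2)

lemma basis_weight_space: "basis_vec n \<in> weight_space"
proof (induction n rule: int_induct[where k=0])
  case base
  show ?case by (rule basis_zero_weight_space)
next
  case (step1 i)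
  have "(\<lambda>n. basis_vec i (n - 1)) = basis_vec (i + 1)" by (auto simp: basis_vec_def fun_eq_iff)
  with bilateral.cyclic_space_comp1[OF step1(2) fourier_weight_ell2] show ?case by simp
next
  case (step2 i)
  have "(\<lambda>n. basis_vec i (n + 1)) = basis_vec (i - 1)" by (auto simp: basis_vec_def fun_eq_iff)
  with weight_space_succ[OF step2(2)] show ?case by simp
qed

lemma bilateral_shift_cyclic_vector:
  "f \<in> ell2 \<Longrightarrow> f \<in> weight_space"
  by (rule bilateral.cyclic_space_of_basis[OF fourier_weight_ell2 _ basis_weight_space])

section \<open>Adding the backward shifts\<close>

text \<open>Indices move against the operator. \<open>Inr (j, 0)\<close> is not in the range, so
  composition with this map sends its basis vector to 0, as the backward shift must.\<close>

definition idx_shift :: "idx \<Rightarrow> idx" where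
  "idx_shift i = (case i of Inl n \<Rightarrow> Inl (n - 1) | Inr (j, n) \<Rightarrow> Inr (j, Suc n))"

lemma T_op_eq: "T_op = (\<lambda>f. f \<circ> idx_shift)"
  by (auto simp: fun_eq_iff T_op_def idx_shift_def bilateral_shift_def unilateral_shift_adj_def split: sum.split)

interpretation idx: inj_comp idx_shift
  by standard (auto intro!: injI simp: idx_shift_def split: sum.splits)

lemma idx_shift_funpow:
  "(idx_shift ^^ m) (Inl n) = Inl (n - int m)"
  "(idx_shift ^^ m) (Inr (j, l)) = Inr (j, l + m)"
  by (induction m) (auto simp: idx_shift_def)

definition lift_Inl :: "(int \<Rightarrow> complex) \<Rightarrow> idx \<Rightarrow> complex" where
  "lift_Inl f = case_sum f (\<lambda>_. 0)"

lemma poly_comp_lift_Inl: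
  "poly_comp idx_shift N c (lift_Inl f) = lift_Inl (poly_comp (\<lambda>n. n - 1) N c f)"
  by (auto simp: fun_eq_iff poly_comp_def lift_Inl_def idx_shift_funpow pred_funpow split: sum.split)

lemma lift_Inl_ell2:
  assumes "f \<in> ell2"
  shows lift_Inl_mem: "lift_Inl f \<in> ell2" and ell2_norm_lift_Inl_le: "ell2_norm (lift_Inl f) \<le> ell2_norm f"
  using assms
  by (auto intro!: ell2_reindex[where \<sigma>=projl and f=f] inj_onI simp: lift_Inl_def split: sum.splits)

lemma half_power_ell2:
  shows half_power_mem: "(\<lambda>n::nat. (1/2) ^ n) \<in> ell2" and ell2_norm_half_power_le: "ell2_norm (\<lambda>n::nat. (1/2) ^ n) \<le> 2"
proof -
  have *: "(\<Sum>n\<in>F. (cmod ((1/2) ^ n))\<^sup>2) \<le> 2\<^sup>2" if "finite F" for F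
  proof -
    have "(\<Sum>n\<in>F. (cmod ((1/2) ^ n))\<^sup>2) = (\<Sum>n\<in>F. (1/4::real) ^ n)"
      by (intro sum.cong) (auto simp: norm_power norm_divide power_divide power2_eq_square simp flip: power_mult_distrib)
    also have "\<dots> \<le> (\<Sum>n. (1/4::real) ^ n)"
      using that by (intro sum_le_suminf summable_geometric) auto
    also have "\<dots> \<le> 2\<^sup>2" by (subst suminf_geometric) auto
    finally show ?thesis .
  qed
  from ell2_boundI[OF *] show "(\<lambda>n::nat. (1/2) ^ n) \<in> ell2" "ell2_norm (\<lambda>n::nat. (1/2) ^ n) \<le> 2" by auto
qed

text \<open>After division by \<open>\<epsilon> i\<close>, \<open>annihilate\<close> bounds the
  contribution of the weight and \<open>decay\<close> that of all later indices, each by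
  \<open>1 / (i + 1)\<close>. \<open>half\<close> makes the tails geometric, and \<open>c0\<close>
  keeps the wanted basis vector with coefficient 1.\<close>

locale fast_decay =
  fixes k :: nat and \<epsilon> :: "nat \<Rightarrow> real" and N :: "nat \<Rightarrow> nat" and c :: "nat \<Rightarrow> nat \<Rightarrow> complex"
  assumes k: "k \<ge> 1" and pos: "\<epsilon> i > 0" and N: "N i > 0" and c0: "c i 0 = 1"
    and annihilate: "ell2_norm (poly_comp (\<lambda>n. n - 1) (N i) (c i) (fourier weight)) \<le> \<epsilon> i / (real i + 1)"
    and half: "\<epsilon> (Suc i) \<le> \<epsilon> i / 2"
    and decay: "2 * (real i + 1) * (\<Sum>m<N i. cmod (c i m)) * \<epsilon> (Suc i) \<le> \<epsilon> i"
begin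

text \<open>The residue modulo \<open>k\<close> makes every copy receive infinitely many indices;
  the set \<open>A\<close> allows splitting into indices below, at and above a given one.\<close>

definition spread :: "nat set \<Rightarrow> idx \<Rightarrow> complex" where
  "spread A = (\<lambda>x. case x of Inl _ \<Rightarrow> 0 | Inr (j, n) \<Rightarrow> if n \<in> A \<and> j = n mod k then of_real (\<epsilon> n) else 0)"

definition cyclic_vec :: "idx \<Rightarrow> complex" where
  "cyclic_vec = (\<lambda>x. lift_Inl (fourier weight) x + spread UNIV x)"

lemma geometric_decay: "\<epsilon> (i + n) \<le> \<epsilon> i * (1/2) ^ n"
proof (induction n)
  case (Suc n)
  then show ?case using half[of "i + n"] by simp
qed simp

text \<open>Each \<open>n\<close> occurs in one copy only, so \<open>n - i\<close> is injective on
  the support and the vector is dominated by a geometric sequence.\<close>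

lemma spread_ell2:
  assumes "A \<subseteq> {i..}"
  shows spread_mem: "spread A \<in> ell2" and ell2_norm_spread_le: "ell2_norm (spread A) \<le> 2 * \<epsilon> i"
proof -
  let ?f = "\<lambda>n::nat. of_real (\<epsilon> i) * (1/2) ^ n :: complex"
  let ?\<sigma> = "\<lambda>x::idx. snd (projr x) - i"
  have f: "?f \<in> ell2" by (intro ell2_scale half_power_mem)
  have inj: "inj_on ?\<sigma> {x. spread A x \<noteq> 0}"
    using assms by (auto simp: inj_on_def spread_def subset_iff split: sum.splits if_splits)
      (metis eq_diff_iff)+
  have le: "cmod (spread A x) \<le> cmod (?f (?\<sigma> x))" if "spread A x \<noteq> 0" for x
  proof -
    obtain n where x: "x = Inr (n mod k, n)" "n \<in> A"
      using \<open>spread A x \<noteq> 0\<close> by (auto simp: spread_def split: sum.splits if_splits)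
    then have "n \<ge> i" using assms by auto
    then have "\<epsilon> n \<le> \<epsilon> i * (1/2) ^ (n - i)" using geometric_decay[of i "n - i"] by simp
    then show ?thesis using x pos[of n] pos[of i]
      by (simp add: spread_def norm_mult norm_power norm_divide)
  qed
  show "spread A \<in> ell2" by (rule ell2_reindex_mem[OF f inj le])
  have "ell2_norm (spread A) \<le> ell2_norm ?f" by (rule ell2_norm_reindex_le[OF f inj le])
  also have "\<dots> \<le> \<epsilon> i * 2"
    unfolding ell2_norm_scale using pos[of i] by (intro mult_mono ell2_norm_half_power_le) auto
  finally show "ell2_norm (spread A) \<le> 2 * \<epsilon> i" by simp
qed

lemma cyclic_vec_ell2: "cyclic_vec \<in> ell2"
  unfolding cyclic_vec_def by (intro ell2_add_mem lift_Inl_mem fourier_weight_ell2 spread_mem[where i=0]) auto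

abbreviation C :: "(idx \<Rightarrow> complex) set" where
  "C \<equiv> cyclic_space idx_shift cyclic_vec"

text \<open>The induction runs over all copies at once, because the terms of lower index may lie in
  any of them.\<close>

lemma unilateral_basis_mem: "j < k \<Longrightarrow> basis_vec (Inr (j, r)) \<in> C"
proof (induction r arbitrary: j rule: less_induct)
  case (less r)
  let ?g = "fourier weight" and ?E = "basis_vec (Inr (j, r)) :: idx \<Rightarrow> complex"
  \<comment> \<open>The image of \<open>?E\<close> under the operator is the previous basis vector,
    or 0 when \<open>r = 0\<close>.\<close>
  have E1: "(\<lambda>x. ?E (idx_shift x)) \<in> C"
  proof (cases r)
    case 0
    then have "(\<lambda>x. ?E (idx_shift x)) = (\<lambda>x. 0)"
      by (auto simp: fun_eq_iff basis_vec_def idx_shift_def split: sum.splits)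
    then show ?thesis using idx.cyclic_space_zero[OF cyclic_vec_ell2] by simp
  next
    case (Suc r')
    then have "(\<lambda>x. ?E (idx_shift x)) = basis_vec (Inr (j, r'))"
      by (auto simp: fun_eq_iff basis_vec_def idx_shift_def split: sum.splits)
    then show ?thesis using less.IH[of r' j] less.prems Suc by simp
  qed
  show ?case
  proof (rule idx.cyclic_spaceI)
    fix e :: real assume e: "e > 0"
    then obtain q0 :: nat where q0: "inverse (real (Suc q0)) < e/2"
      using reals_Archimedean[of "e/2"] by auto
    \<comment> \<open>An index of residue \<open>j\<close>, at least \<open>r\<close> so that it can
      be shifted down to \<open>r\<close>, and at least \<open>q0\<close> so that
      \<open>1 / (i + 1) < e/2\<close>.\<close>
    define i where "i = k * (q0 + r) + j"
    have "q0 + r \<le> k * (q0 + r)" using k by simp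
    then have "q0 + r \<le> i" unfolding i_def by (rule trans_le_add1)
    then have i: "r \<le> i" "q0 \<le> i" "i mod k = j"
      using less.prems by (auto simp: i_def)
    have ei: "1 / (real i + 1) < e/2"
    proof -
      have "1 / (real i + 1) \<le> inverse (real (Suc q0))"
        using i(2) by (simp add: divide_simps)
      with q0 show ?thesis by simp
    qed
    \<comment> \<open>The operator \<open>p_i(T) T^(i-r) / \<epsilon> i\<close>, which keeps the
      cyclic space invariant.\<close>
    define A where "A f x = of_real (1 / \<epsilon> i) * poly_comp idx_shift (N i) (c i) f ((idx_shift ^^ (i - r)) x)" for f x
    have A_mem: "A f \<in> C" if "(\<lambda>x. f ((idx_shift ^^ (i - r)) x)) \<in> C" for f
      unfolding A_def poly_comp_funpow
      by (intro idx.cyclic_space_scale idx.cyclic_space_poly_comp_mem that cyclic_vec_ell2)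
    have A_norm: "ell2_norm (A f) \<le> ell2_norm (poly_comp idx_shift (N i) (c i) f) / \<epsilon> i" 
      and A_ell2: "A f \<in> ell2" if "f \<in> ell2" for f
    proof -
      show "A f \<in> ell2" unfolding A_def
        by (intro ell2_scale idx.comp_ell2_mem idx.poly_comp_mem that)
      show "ell2_norm (A f) \<le> ell2_norm (poly_comp idx_shift (N i) (c i) f) / \<epsilon> i"
        unfolding A_def ell2_norm_scale using pos[of i] idx.ell2_norm_comp_le[OF idx.poly_comp_mem[OF that], of "N i" "c i" "i - r"]
        by (simp add: norm_divide divide_right_mono)
    qed
    have A_add: "A (\<lambda>x. f x + f' x) x = A f x + A f' x" for f f' x
      by (simp add: A_def poly_comp_add ring_distribs)
    let ?low = "spread {..<i}" and ?tail = "spread {Suc i..}"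
    let ?mid = "\<lambda>x. of_real (\<epsilon> i) * basis_vec (Inr (j, i)) x"
    have "cyclic_vec = (\<lambda>x. (lift_Inl ?g x + ?tail x) + (?low x + ?mid x))"
      using i(3) by (auto simp: fun_eq_iff cyclic_vec_def spread_def basis_vec_def split: sum.splits)
        (metis Suc_leI linorder_neqE_nat)
    then have Avec: "A cyclic_vec x = (A (lift_Inl ?g) x + A ?tail x) + (A ?low x + A ?mid x)" for x
      by (simp add: A_add)
    \<comment> \<open>The shift brings index \<open>i\<close> down to \<open>r\<close>. The constant
      term gives \<open>?E\<close>; all other terms are a polynomial applied to the image of
      \<open>?E\<close>, already in the space by \<open>E1\<close>.\<close>
    have Amid: "A ?mid x = ?E x + poly_comp idx_shift (N i - 1) (\<lambda>m. c i (Suc m)) (\<lambda>x. ?E (idx_shift x)) x" for x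
    proof -
      have "A ?mid x = poly_comp idx_shift (N i) (c i) (\<lambda>x. basis_vec (Inr (j, i)) ((idx_shift ^^ (i - r)) x)) x"
        unfolding A_def poly_comp_funpow poly_comp_scale using pos[of i] by simp
      also have "(\<lambda>x. basis_vec (Inr (j, i)) ((idx_shift ^^ (i - r)) x)) = ?E"
      proof -
        have "(idx_shift ^^ (i - r)) x = Inr (j, i) \<longleftrightarrow> x = Inr (j, r)" for x
          using inj_eq[OF idx.inj_pow, of "i - r" x "Inr (j, r)"] i(1) by (simp add: idx_shift_funpow)
        then show ?thesis by (simp add: basis_vec_def)
      qed
      also have "poly_comp idx_shift (N i) (c i) ?E x = poly_comp idx_shift (Suc (N i - 1)) (c i) ?E x"
        using N[of i] by simp
      also have "\<dots> = ?E x + poly_comp idx_shift (N i - 1) (\<lambda>m. c i (Suc m)) (\<lambda>x. ?E (idx_shift x)) x"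
        unfolding poly_comp_def sum.lessThan_Suc_shift by (simp add: c0)
      finally show ?thesis .
    qed
    \<comment> \<open>Indices below \<open>i\<close> drop below \<open>r\<close> after the shift by
      \<open>i - r\<close>, so the induction hypothesis covers them.\<close>
    have low: "A ?low \<in> C"
    proof (rule A_mem, rule idx.cyclic_space_of_basis[OF cyclic_vec_ell2])
      show "(\<lambda>x. ?low ((idx_shift ^^ (i - r)) x)) \<in> ell2"
        by (intro idx.comp_ell2_mem spread_mem[where i=0]) auto
      fix x assume "?low ((idx_shift ^^ (i - r)) x) \<noteq> 0"
      then obtain j' n where "x = Inr (j', n)" "n + (i - r) < i" "j' = (n + (i - r)) mod k"
        by (cases x) (auto simp: spread_def idx_shift_funpow split: if_splits)
      then show "basis_vec x \<in> C" using less.IH[of n j'] i(1) k by simp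
    qed
    \<comment> \<open>Removing the parts known to lie in the space leaves \<open>?E\<close> plus the
      contributions of the weight and of the tail, both small.\<close>
    define w where "w x = A cyclic_vec x - A ?low x - poly_comp idx_shift (N i - 1) (\<lambda>m. c i (Suc m)) (\<lambda>x. ?E (idx_shift x)) x" for x
    have w: "w \<in> C"
      unfolding w_def
      by (intro idx.cyclic_space_diff idx.cyclic_space_poly_comp_mem low E1 cyclic_vec_ell2 A_mem
          idx.cyclic_space_comp idx.cyclic_space_base)
    have tail: "?tail \<in> ell2" "ell2_norm ?tail \<le> 2 * \<epsilon> (Suc i)"
      using spread_ell2[of "{Suc i..}" "Suc i"] by auto
    have g: "lift_Inl ?g \<in> ell2" by (intro lift_Inl_mem fourier_weight_ell2)
    have "ell2_norm (\<lambda>x. ?E x - w x) = ell2_norm (\<lambda>x. -1 * (A (lift_Inl ?g) x + A ?tail x))"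
      by (simp add: w_def Avec Amid algebra_simps)
    also have "\<dots> = ell2_norm (\<lambda>x. A (lift_Inl ?g) x + A ?tail x)"
      unfolding ell2_norm_scale by simp
    also have "\<dots> \<le> ell2_norm (A (lift_Inl ?g)) + ell2_norm (A ?tail)"
      by (intro ell2_norm_triangle A_ell2 tail g)
    finally have split: "ell2_norm (\<lambda>x. ?E x - w x) \<le> ell2_norm (A (lift_Inl ?g)) + ell2_norm (A ?tail)" .
    have head_le: "ell2_norm (A (lift_Inl ?g)) \<le> 1 / (real i + 1)"
    proof -
      have "ell2_norm (A (lift_Inl ?g)) \<le> ell2_norm (lift_Inl (poly_comp (\<lambda>n. n - 1) (N i) (c i) ?g)) / \<epsilon> i"
        using A_norm[OF g] by (simp add: poly_comp_lift_Inl)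
      also have "\<dots> \<le> (\<epsilon> i / (real i + 1)) / \<epsilon> i"
        using pos[of i] annihilate[of i]
        by (intro divide_right_mono order_trans[OF ell2_norm_lift_Inl_le] bilateral.poly_comp_mem fourier_weight_ell2) auto
      finally show ?thesis using pos[of i] by simp
    qed
    have tail_le: "ell2_norm (A ?tail) \<le> 1 / (real i + 1)"
    proof -
      let ?B = "\<Sum>m<N i. cmod (c i m)"
      have "ell2_norm (poly_comp idx_shift (N i) (c i) ?tail) \<le> ?B * ell2_norm ?tail"
        by (rule idx.ell2_norm_poly_comp_le[OF tail(1)])
      also have "\<dots> \<le> ?B * (2 * \<epsilon> (Suc i))" using tail(2) by (intro mult_left_mono sum_nonneg) auto
      also have "\<dots> \<le> \<epsilon> i / (real i + 1)"
        using decay[of i] by (simp add: field_simps)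
      finally have "ell2_norm (poly_comp idx_shift (N i) (c i) ?tail) / \<epsilon> i \<le> (\<epsilon> i / (real i + 1)) / \<epsilon> i"
        using pos[of i] by (intro divide_right_mono) auto
      then show ?thesis using A_norm[OF tail(1)] pos[of i] by simp
    qed
    have "ell2_norm (\<lambda>x. ?E x - w x) < e" using split head_le tail_le ei by linarith
    with w show "\<exists>w\<in>C. ell2_norm (\<lambda>x. ?E x - w x) < e" by blast
  qed (auto intro: basis_vec_ell2 cyclic_vec_ell2)
qed

text \<open>The whole unilateral part of \<open>cyclic_vec\<close> is a limit of basis vectors
  already reached, so it can be subtracted.\<close>

lemma lift_Inl_weight_mem: "lift_Inl (fourier weight) \<in> C"
proof -
  have "spread UNIV \<in> C"
  proof (rule idx.cyclic_space_of_basis[OF cyclic_vec_ell2 spread_mem[where i=0]])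
    fix x assume "spread UNIV x \<noteq> 0"
    then obtain n where "x = Inr (n mod k, n)" by (auto simp: spread_def split: sum.splits if_splits)
    then show "basis_vec x \<in> C" using unilateral_basis_mem k by simp
  qed auto
  from idx.cyclic_space_diff[OF idx.cyclic_space_base[OF cyclic_vec_ell2] this cyclic_vec_ell2]
  show ?thesis by (simp add: cyclic_vec_def)
qed

lemma lift_Inl_mem_cyclic:
  assumes "f \<in> ell2"
  shows "lift_Inl f \<in> C"
proof (rule idx.cyclic_spaceI)
  fix e :: real assume "e > 0"
  then obtain M d where d: "ell2_norm (\<lambda>n. f n - poly_comp (\<lambda>n. n - 1) M d (fourier weight) n) < e"
    using bilateral_shift_cyclic_vector[OF assms] by (auto simp: cyclic_space_def)
  let ?p = "poly_comp idx_shift M d (lift_Inl (fourier weight))"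
  have "ell2_norm (\<lambda>x. lift_Inl f x - ?p x) = ell2_norm (lift_Inl (\<lambda>n. f n - poly_comp (\<lambda>n. n - 1) M d (fourier weight) n))"
    unfolding poly_comp_lift_Inl by (rule arg_cong[where f=ell2_norm]) (auto simp: fun_eq_iff lift_Inl_def split: sum.splits)
  also have "\<dots> < e"
    by (rule le_less_trans[OF ell2_norm_lift_Inl_le d])
      (intro ell2_diff_mem assms bilateral.poly_comp_mem fourier_weight_ell2)
  finally show "\<exists>h\<in>C. ell2_norm (\<lambda>x. lift_Inl f x - h x) < e"
    using idx.cyclic_space_poly_comp_mem[OF lift_Inl_weight_mem cyclic_vec_ell2] by blast
qed (auto intro: lift_Inl_mem assms cyclic_vec_ell2)

lemma H_space_subset_cyclic: "H_space k \<subseteq> C"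
proof
  fix f assume f: "f \<in> H_space k"
  then have fe: "f \<in> ell2" by (simp add: H_space_def ell2_def)
  have 1: "lift_Inl (\<lambda>n. f (Inl n)) \<in> C"
    using fe by (intro lift_Inl_mem_cyclic ell2_reindex_mem[OF fe, where \<sigma>=Inl]) auto
  have 2: "(\<lambda>x. f x - lift_Inl (\<lambda>n. f (Inl n)) x) \<in> C"
  proof (rule idx.cyclic_space_of_basis[OF cyclic_vec_ell2])
    show "(\<lambda>x. f x - lift_Inl (\<lambda>n. f (Inl n)) x) \<in> ell2"
      by (intro ell2_diff_mem fe idx.cyclic_space_ell2[OF 1])
    fix x assume "f x - lift_Inl (\<lambda>n. f (Inl n)) x \<noteq> 0"
    then obtain j n where x: "x = Inr (j, n)" "f x \<noteq> 0" by (cases x) (auto simp: lift_Inl_def)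
    then have "j < k" using f by (auto simp: H_space_def not_less[symmetric])
    then show "basis_vec x \<in> C" using x unilateral_basis_mem by simp
  qed
  from idx.cyclic_space_add[OF 1 2 cyclic_vec_ell2] show "f \<in> C" by simp
qed

lemma cyclic_op_T_op: "cyclic_op (H_space k) T_op"
proof -
  have "cyclic_vec \<in> H_space k"
  proof -
    have "cyclic_vec (Inr (j, n)) = 0" if "k \<le> j" for j n
    proof -
      have "n mod k < k" using k by simp
      with that show ?thesis by (auto simp: cyclic_vec_def lift_Inl_def spread_def)
    qed
    then show ?thesis using cyclic_vec_ell2 by (simp add: H_space_def ell2_def)
  qed
  moreover have "\<exists>N c. ell2_norm (\<lambda>i. f i - (\<Sum>m<N. c m * (T_op ^^ m) cyclic_vec i)) < e"
    if "f \<in> H_space k" "e > 0" for f e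
    using H_space_subset_cyclic that unfolding T_op_eq comp_power by (auto simp: cyclic_space_def poly_comp_def)
  ultimately show ?thesis unfolding cyclic_op_def by blast
qed

end

section \<open>Recursive choice of the coefficients and polynomials\<close>

lemma fast_decay_exists:
  assumes "k \<ge> 1"
  obtains \<epsilon> N c where "fast_decay k \<epsilon> N c"
proof -
  \<comment> \<open>The triples consist of \<open>\<epsilon> i\<close>, \<open>N i\<close> and
    \<open>c i\<close>. \<open>P\<close> concerns one stage; \<open>Q\<close> bounds the next
    coefficient by means of the current polynomial, so each coefficient is fixed before its own
    polynomial.\<close>
  define P where "P i x \<longleftrightarrow> 0 < fst x \<and> 0 < fst (snd x) \<and> snd (snd x) 0 = 1 \<and>
      ell2_norm (poly_comp (\<lambda>n. n - 1) (fst (snd x)) (snd (snd x)) (fourier weight)) \<le> fst x / (real i + 1)"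
    for i :: nat and x :: "real \<times> nat \<times> (nat \<Rightarrow> complex)"
  define Q where "Q i x y \<longleftrightarrow> fst y \<le> fst x / 2 \<and>
      2 * (real i + 1) * (\<Sum>m<fst (snd x). cmod (snd (snd x) m)) * fst y \<le> fst x"
    for i :: nat and x y :: "real \<times> nat \<times> (nat \<Rightarrow> complex)"
  have ex: "\<exists>y. P i y \<and> fst y = \<delta>" if "\<delta> > 0" for \<delta> i
  proof -
    have "\<delta> / (real i + 1) > 0" using that by simp
    then obtain N c where "0 < N" "c 0 = 1"
      "ell2_norm (poly_comp (\<lambda>n. n - 1) N c (fourier weight)) \<le> \<delta> / (real i + 1)"
      by (rule fourier_weight_annihilated)
    with that have "P i (\<delta>, N, c)" by (simp add: P_def)
    then show ?thesis by (intro exI[of _ "(\<delta>, N, c)"]) simp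
  qed
  have "\<exists>x. \<forall>i. P i (x i) \<and> Q i (x i) (x (Suc i))"
  proof (rule dependent_nat_choice)
    show "\<exists>x. P 0 x" using ex[of 1 0] by auto
    fix x i assume "P i x"
    then have x: "fst x > 0" by (simp add: P_def)
    define B where "B = 2 * (real i + 1) * (\<Sum>m<fst (snd x). cmod (snd (snd x) m))"
    have B: "B \<ge> 0" unfolding B_def by (intro mult_nonneg_nonneg sum_nonneg) auto
    \<comment> \<open>In the denominator the 2 secures halving and \<open>B\<close> the decay
      condition.\<close>
    define \<delta> where "\<delta> = fst x / (2 + B)"
    have \<delta>: "\<delta> > 0" using B x unfolding \<delta>_def by (intro divide_pos_pos) auto
    then obtain y where y: "P (Suc i) y" "fst y = \<delta>" using ex by blast
    have "\<delta> \<le> fst x / 2" unfolding \<delta>_def using B x by (intro divide_left_mono) auto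
    moreover have "B * \<delta> \<le> fst x"
    proof -
      have "B * \<delta> \<le> (2 + B) * \<delta>" using \<delta> by (intro mult_right_mono) auto
      also have "\<dots> = fst x"
        using B by (simp add: \<delta>_def)
      finally show ?thesis .
    qed
    ultimately have "Q i x y" unfolding Q_def y(2) B_def by (rule conjI)
    with y(1) show "\<exists>y. P (Suc i) y \<and> Q i x y" by blast
  qed
  then obtain x where x: "\<And>i. P i (x i)" "\<And>i. Q i (x i) (x (Suc i))" by blast
  have "fast_decay k (\<lambda>i. fst (x i)) (\<lambda>i. fst (snd (x i))) (\<lambda>i. snd (snd (x i)))"
  proof
    fix i
    show "0 < fst (x i)" "0 < fst (snd (x i))" "snd (snd (x i)) 0 = 1"
      "ell2_norm (poly_comp (\<lambda>n. n - 1) (fst (snd (x i))) (snd (snd (x i))) (fourier weight)) \<le> fst (x i) / (real i + 1)"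
      using x(1)[of i] unfolding P_def by blast+
    show "fst (x (Suc i)) \<le> fst (x i) / 2"
      "2 * (real i + 1) * (\<Sum>m<fst (snd (x i)). cmod (snd (snd (x i)) m)) * fst (x (Suc i)) \<le> fst (x i)"
      using x(2)[of i] unfolding Q_def by blast+
  qed (rule assms)
  then show ?thesis by (rule that)
qed

theorem mainTheorem19:
  fixes k :: nat
  assumes "k \<ge> 1"
  shows "cyclic_op (H_space k) T_op"
  using fast_decay_exists[OF assms] fast_decay.cyclic_op_T_op by blast

end
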